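(* Let $H$ be a separable real Hilbert space and consider the cost $\mathsf c:=\frac12 w_2^2$ on $\mathcal P_2(H)\times\mathcal P_2(H)$. Let $\phi,\psi:\mathcal P_2(H)\to\mathbb R\cup\{+\infty\}$ with $\phi$ proper, and set $\mathcal U:=\frac12 m_2^2-\phi$, $\mathcal V:=\frac12 m_2^2-\psi$. Then: 1. $\psi=\phi^\star$ if and only if $\mathcal V=\mathcal U^{\mathsf c}$. 2. $\phi$ is totally convex and lower semicontinuous if and only if $\mathcal U$ is $\mathsf c$-concave (and thus upper semicontinuous). 3. For every $\mu,\nu\in\mathcal P_2(H)$ with $\phi(\mu)\in\mathbb R$ (and thus $\mathcal U(\mu)\in\mathbb R$ as well), $\nu\in\partial^-\phi(\mu)$ if and only if $\nu\in\partial^+_{\mathsf c}\,\mathcal U(\mu)$.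
   Context: $\mathcal P_2(H)$ is the space of Borel probability measures $\mu$ on $H$ with $m_2^2(\mu):=\int_H|x|^2\,d\mu<\infty$, endowed with the 2-Wasserstein metric $w_2$, $w_2^2(\mu,\nu)=\min\{\int|x-y|^2d\gamma:\gamma\in\Gamma(\mu,\nu)\}$, where $\Gamma(\mu,\nu)$ is the set of couplings. $[\mu,\nu]:=\max\{\int\langle x,y\rangle\,d\gamma:\gamma\in\Gamma(\mu,\nu)\}$. Proper means not identically $+\infty$ (resp. $-\infty$ for functions with values in $\mathbb R\cup\{-\infty\}$). $\phi^\star(\nu):=\sup_{\mu}\big([\nu,\mu]-\phi(\mu)\big)$. For $\phi(\mu)\in\mathbb R$, $\partial^-\phi(\mu)$ is the set of $\nu\in\mathcal P_2(H)$ with $\phi(\mu')-\phi(\mu)\ge[\mu',\nu]-[\mu,\nu]$ for every $\mu'\in\mathcal P_2(H)$. For proper $f:\mathcal P_2(H)\to\mathbb R\cup\{-\infty\}$: $f^{\mathsf c}(\nu):=\inf_{\mu}\big(\mathsf c(\mu,\nu)-f(\mu)\big)$; $f$ is $\mathsf c$-concave if there is a set $A\subset\mathcal P_2(H)\times\mathbb R$ with $f(\mu)=\inf_{(\nu,a)\in A}\big(\mathsf c(\mu,\nu)-a\big)$ for every $\mu$; if $f(\mu)\in\mathbb R$, then $\nu\in\partial^+_{\mathsf c}f(\mu)$ means $f(\mu')-f(\mu)\le\mathsf c(\mu',\nu)-\mathsf c(\mu,\nu)$ for every $\mu'\in\mathcal P_2(H)$. A function $\phi:\mathcal P_2(H)\to\mathbb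 R\cup\{+\infty\}$ is totally convex if for every $\boldsymbol\mu\in\mathcal P_2(H\times H)$ with marginals $\mu_0,\mu_1$ and every $t\in[0,1]$, $\phi((\pi_t)_\sharp\boldsymbol\mu)\le(1-t)\phi(\mu_0)+t\phi(\mu_1)$, where $\pi_t(x_1,x_2)=(1-t)x_1+tx_2$. *)

theory Defs
  imports "HOL-Probability.Probability"
begin

text \<open>
  A separable real Hilbert space is a type of sort \<open>{real_inner, polish_space}\<close>
  (\<open>polish_space\<close> is \<open>complete_space\<close> plus \<open>second_countable_topology\<close>).  Functions on
  \<open>P2\<close> are rendered as total functions on measures; only their values on \<open>P2\<close> are ever used.
\<close>

definition P2 :: "'a::real_normed_vector measure set" where
  "P2 = {\<mu>. prob_space \<mu> \<and> sets \<mu> = sets borel \<and> integrable \<mu> (\<lambda>x. (norm x)\<^sup>2)}"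

definition m2 :: "'a::{real_inner, polish_space} measure \<Rightarrow> real" where
  "m2 \<mu> = sqrt (LINT x|\<mu>. (norm x)\<^sup>2)"

definition couplings ::
  "'a::{real_inner, polish_space} measure \<Rightarrow> 'a measure \<Rightarrow> ('a \<times> 'a) measure set" where
  "couplings \<mu> \<nu> = {\<gamma>. prob_space \<gamma> \<and> sets \<gamma> = sets borel \<and>
     distr \<gamma> borel fst = \<mu> \<and> distr \<gamma> borel snd = \<nu>}"

text \<open>
  The minimum in the definition of \<open>w2\<close> and the maximum in that of \<open>corr\<close> are attained on
  \<open>P2\<close>, so they are the infimum and the supremum.  On \<open>P2\<close> these are taken over sets of reals
  that are nonempty (product coupling) and bounded (Cauchy-Schwarz), so the real-valued
  \<open>Inf\<close> and \<open>Sup\<close> are the genuine ones.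
\<close>

definition w2 :: "'a::{real_inner, polish_space} measure \<Rightarrow> 'a measure \<Rightarrow> real" where
  "w2 \<mu> \<nu> = sqrt (INF \<gamma>\<in>couplings \<mu> \<nu>. LINT p|\<gamma>. (norm (fst p - snd p))\<^sup>2)"

definition corr :: "'a::{real_inner, polish_space} measure \<Rightarrow> 'a measure \<Rightarrow> real" where
  "corr \<mu> \<nu> = (SUP \<gamma>\<in>couplings \<mu> \<nu>. LINT p|\<gamma>. fst p \<bullet> snd p)"

definition cost :: "'a::{real_inner, polish_space} measure \<Rightarrow> 'a measure \<Rightarrow> real" where
  "cost \<mu> \<nu> = (1/2) * (w2 \<mu> \<nu>)\<^sup>2"

definition conjugate ::
  "('a::{real_inner, polish_space} measure \<Rightarrow> ereal) \<Rightarrow> 'a measure \<Rightarrow> ereal" where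
  "conjugate \<phi> \<nu> = (SUP \<mu>\<in>P2. ereal (corr \<nu> \<mu>) - \<phi> \<mu>)"

text \<open>The sub- and superdifferentials are meant only at points where the function is finite.\<close>

definition subdiff ::
  "('a::{real_inner, polish_space} measure \<Rightarrow> ereal) \<Rightarrow> 'a measure \<Rightarrow> 'a measure set" where
  "subdiff \<phi> \<mu> = {\<nu>\<in>P2. \<forall>\<mu>'\<in>P2. \<phi> \<mu>' - \<phi> \<mu> \<ge> ereal (corr \<mu>' \<nu> - corr \<mu> \<nu>)}"

definition c_transform ::
  "('a::{real_inner, polish_space} measure \<Rightarrow> ereal) \<Rightarrow> 'a measure \<Rightarrow> ereal" where
  "c_transform f \<nu> = (INF \<mu>\<in>P2. ereal (cost \<mu> \<nu>) - f \<mu>)"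

definition c_concave :: "('a::{real_inner, polish_space} measure \<Rightarrow> ereal) \<Rightarrow> bool" where
  "c_concave f \<longleftrightarrow> (\<exists>A \<subseteq> P2 \<times> (UNIV :: real set).
     \<forall>\<mu>\<in>P2. f \<mu> = (INF (\<nu>, a)\<in>A. ereal (cost \<mu> \<nu> - a)))"

definition c_superdiff ::
  "('a::{real_inner, polish_space} measure \<Rightarrow> ereal) \<Rightarrow> 'a measure \<Rightarrow> 'a measure set" where
  "c_superdiff f \<mu> = {\<nu>\<in>P2. \<forall>\<mu>'\<in>P2. f \<mu>' - f \<mu> \<le> ereal (cost \<mu>' \<nu> - cost \<mu> \<nu>)}"

text \<open>Since \<open>0 * \<infinity> = 0\<close> in \<open>ereal\<close>, the inequality is trivial for \<open>t \<in> {0, 1}\<close>.\<close>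

definition totally_convex :: "('a::{real_inner, polish_space} measure \<Rightarrow> ereal) \<Rightarrow> bool" where
  "totally_convex \<phi> \<longleftrightarrow> (\<forall>M \<in> (P2 :: ('a \<times> 'a) measure set). \<forall>t\<in>{0..1::real}.
     \<phi> (distr M borel (\<lambda>(x, y). (1 - t) *\<^sub>R x + t *\<^sub>R y))
       \<le> ereal (1 - t) * \<phi> (distr M borel fst) + ereal t * \<phi> (distr M borel snd))"

text \<open>Semicontinuity on \<open>P2\<close> with respect to the metric \<open>w2\<close>.\<close>

definition lsc_w2 :: "('a::{real_inner, polish_space} measure \<Rightarrow> ereal) \<Rightarrow> bool" where
  "lsc_w2 \<phi> \<longleftrightarrow> (\<forall>\<mu>\<in>P2. \<forall>r < \<phi> \<mu>. \<exists>\<delta>>0. \<forall>\<nu>\<in>P2. w2 \<mu> \<nu> < \<delta> \<longrightarrow> r < \<phi> \<nu>)"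

definition usc_w2 :: "('a::{real_inner, polish_space} measure \<Rightarrow> ereal) \<Rightarrow> bool" where
  "usc_w2 f \<longleftrightarrow> (\<forall>\<mu>\<in>P2. \<forall>r > f \<mu>. \<exists>\<delta>>0. \<forall>\<nu>\<in>P2. w2 \<mu> \<nu> < \<delta> \<longrightarrow> f \<nu> < r)"

end

theory Submission
  imports Defs
begin

text \<open>
  On \<open>P2\<close> the cost is \<open>cost \<mu> \<nu> = m2 \<mu>\<^sup>2 / 2 + m2 \<nu>\<^sup>2 / 2 - corr \<mu> \<nu>\<close>, so adding the finite quadratic
  terms turns conjugates into c-transforms and subgradients into c-supergradients, and \<open>U\<close> is
  c-concave iff \<open>\<phi>\<close> is a supremum of functions \<open>corr \<cdot> \<nu> - b\<close>.  It remains to identify such suprema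
  with the totally convex lower semicontinuous functions.

  Every measure in \<open>P2\<close> is the law of a variable in the Hilbert space \<open>L2\<close> over the unit interval,
  and \<open>corr \<mu> \<nu>\<close> is the supremum of \<open>X \<bullet> Y\<close> over variables with these laws.  As the interval is
  atomless, the supremum does not change if \<open>X\<close> is fixed in advance and only \<open>Y\<close> varies.  This makes
  \<open>corr \<cdot> \<nu>\<close> totally convex and continuous.  Conversely, \<open>\<phi> \<circ> law\<close> is convex and lower
  semicontinuous on \<open>L2\<close>, hence a supremum of affine functions \<open>X \<mapsto> X \<bullet> Y - a\<close>; by law invariance
  each of these lies below \<open>\<phi> \<circ> law\<close> together with \<open>corr \<cdot> (law Y) - a\<close>.
\<close>

section \<open>Borel probability measures on Polish spaces as laws on the unit interval\<close>

instance prod :: (polish_space, polish_space) polish_space ..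

text \<open>As a measure on all of \<open>real\<close> it makes random variables total Borel
  functions; the endpoints, where a quantile may be infinite, are left out.\<close>

definition unit_prob :: "real measure" where
  "unit_prob = uniform_measure lborel {0<..<1}"

lemma sets_unit_prob [measurable_cong, simp]: "sets unit_prob = sets borel"
  by (simp add: unit_prob_def)

lemma space_unit_prob [simp]: "space unit_prob = UNIV"
  by (simp add: unit_prob_def)

lemma emeasure_unit_prob: "A \<in> sets borel \<Longrightarrow> emeasure unit_prob A = emeasure lborel ({0<..<1} \<inter> A)"
  by (simp add: unit_prob_def divide_ennreal_def)

interpretation unit_prob: prob_space unit_prob
  by (rule prob_spaceI) (simp add: emeasure_unit_prob)

lemma unit_prob_singleton: "emeasure unit_prob {x} = 0"
proof -
  have "emeasure lborel ({0<..<1} \<inter> {x}) \<le> emeasure lborel {x}"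
    by (rule emeasure_mono) auto
  then show ?thesis by (simp add: emeasure_unit_prob)
qed

lemma AE_unit_prob: "AE u in unit_prob. u \<in> {0<..<1}"
  unfolding unit_prob_def by (rule AE_uniform_measureI) auto

section \<open>Quantile transform of real distributions\<close>

context cdf_distribution
begin

text \<open>\<open>I\<close> is the pseudoinverse of the distribution function \<open>C\<close>,
  meaningful on the open unit interval; the default 0 elsewhere sits on a null set of
  \<open>unit_prob\<close>.\<close>

definition quantile :: "real \<Rightarrow> real" where
  "quantile u = (if u \<in> {0<..<1} then I u else 0)"

lemma measurable_quantile [measurable]: "quantile \<in> borel_measurable borel"
proof -
  have "I \<in> borel_measurable (restrict_space borel {0<..<1})"
    by (rule measurable_CI)
  then show ?thesis
    unfolding quantile_def [abs_def]
    by (subst (asm) measurable_restrict_space_iff[where c=0]) auto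
qed

lemma distr_quantile: "distr unit_prob borel quantile = M"
proof -
  have "distr unit_prob borel quantile = distr (restrict_space lborel {0<..<1}) borel I"
  proof (rule measure_eqI)
    fix A assume "A \<in> sets (distr unit_prob borel quantile)"
    then have [measurable]: "A \<in> sets borel" by simp
    have "emeasure (distr unit_prob borel quantile) A = emeasure lborel ({0<..<1} \<inter> quantile -` A)"
      using measurable_sets_borel[OF measurable_quantile] by (simp add: emeasure_distr emeasure_unit_prob)
    also have "{0<..<1} \<inter> quantile -` A = {0<..<1} \<inter> I -` A"
      by (auto simp: quantile_def)
    also have "emeasure lborel \<dots> = emeasure (distr (restrict_space lborel {0<..<1}) borel I) A"
      by (subst emeasure_distr)
         (auto simp: emeasure_restrict_space space_restrict_space intro!: arg_cong[where f="emeasure lborel"])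
    finally show "emeasure (distr unit_prob borel quantile) A = 
      emeasure (distr (restrict_space lborel {0<..<1}) borel I) A" .
  qed simp
  then show ?thesis by (simp add: distr_I_eq_M)
qed

text \<open>Without atoms \<open>C\<close> is continuous, hence a left inverse of
  \<open>quantile\<close> on the interval; as \<open>quantile\<close> has law \<open>M\<close>,
  applying \<open>C\<close> recovers the uniform law.\<close>

lemma distr_cdf:
  assumes "\<And>x. measure M {x} = 0"
  shows "distr M borel C = unit_prob"
proof -
  have "C (quantile u) = u" if u: "u \<in> {0<..<1}" for u
  proof (rule antisym)
    obtain i where q: "quantile u = i" and iff: "\<And>x. u \<le> C x \<longleftrightarrow> i \<le> x"
    proof
      show "quantile u = I u" using u by (simp add: quantile_def)
      show "u \<le> C x \<longleftrightarrow> I u \<le> x" for x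
        by (rule pseudoinverse) (use u in \<open>simp_all only: greaterThanLessThan_iff\<close>)
    qed
    show "u \<le> C (quantile u)" by (simp add: q iff)
    \<comment> \<open>To the left of the quantile \<open>C\<close> is at most \<open>u\<close>;
      continuity passes the bound to the quantile itself.\<close>
    have "isCont C i" using assms isCont_cdf by blast
    then have "(C \<longlongrightarrow> C i) (at_left i)"
      by (simp add: isCont_def filterlim_at_split)
    moreover have "C x \<le> u" if "x < i" for x
      using iff[of x] that by linarith
    then have "eventually (\<lambda>x. C x \<le> u) (at_left i)"
      by (simp add: eventually_at_filter)
    ultimately show "C (quantile u) \<le> u"
      unfolding q by (intro tendsto_upperbound) auto
  qed
  then have "AE u in unit_prob. C (quantile u) = u"
    using AE_unit_prob by auto
  then have "distr unit_prob borel (C \<circ> quantile) = distr unit_prob borel (\<lambda>u. u)"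
    by (intro distr_cong_AE) auto
  then have "distr (distr unit_prob borel quantile) borel C = distr unit_prob borel (\<lambda>u. u)"
    by (subst distr_distr) auto
  then show ?thesis
    using distr_id2[of borel unit_prob] by (simp add: distr_quantile)
qed

end

section \<open>Borel embedding of Polish spaces into the line\<close>

lemma borel_measurable_lim_Cauchy:
  fixes f :: "nat \<Rightarrow> 'a \<Rightarrow> 'b::polish_space"
  assumes [measurable]: "\<And>i. f i \<in> borel_measurable M"
  shows "(\<lambda>x. if Cauchy (\<lambda>i. f i x) then lim (\<lambda>i. f i x) else c) \<in> borel_measurable M"
proof (rule borel_measurable_LIMSEQ_metric)
  show "(\<lambda>x. if Cauchy (\<lambda>i. f i x) then f i x else c) \<in> borel_measurable M" for i
    by measurable
  show "(\<lambda>i. if Cauchy (\<lambda>i. f i x) then f i x else c) \<longlonglongrightarrow>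
    (if Cauchy (\<lambda>i. f i x) then lim (\<lambda>i. f i x) else c)" for x
    by (auto simp: Cauchy_convergent_iff convergent_LIMSEQ_iff)
qed

text \<open>On a number with ternary digits 0 and 1, units digit first, this deletes the leading
  digit and moves the others up one place.\<close>

definition ternary_shift :: "real \<Rightarrow> real" where
  "ternary_shift s = 3 * (s - of_bool (1 \<le> s))"

definition ternary_sum :: "(nat \<Rightarrow> bool) \<Rightarrow> real" where
  "ternary_sum b = (\<Sum>m. of_bool (b m) * (1/3) ^ m)"

lemma summable_ternary: "summable (\<lambda>m. of_bool (b m) * (1/3) ^ m :: real)"
  by (rule summable_comparison_test'[OF summable_geometric[of "1/3"]]) auto

text \<open>Digits \<open>0\<close> and \<open>1\<close> in base 3: the tail of the series is at most \<open>1/2\<close>, so the leading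
  digit can be read off the sum.\<close>

lemma ternary_sum_tail: "ternary_sum b = of_bool (b 0) + ternary_sum (b \<circ> Suc) / 3"
proof -
  have "ternary_sum b = of_bool (b 0) + (\<Sum>m. of_bool (b (Suc m)) * (1/3) ^ Suc m)"
    unfolding ternary_sum_def using suminf_split_head[OF summable_ternary[of b]] by simp
  also have "(\<Sum>m. of_bool (b (Suc m)) * (1/3) ^ Suc m) = (\<Sum>m. of_bool ((b \<circ> Suc) m) * (1/3) ^ m / (3::real))"
    by simp
  also have "\<dots> = ternary_sum (b \<circ> Suc) / 3"
    unfolding ternary_sum_def by (rule suminf_divide[OF summable_ternary])
  finally show ?thesis .
qed

lemma ternary_sum_bounds: "0 \<le> ternary_sum b" "ternary_sum b \<le> 3/2"
proof -
  show "0 \<le> ternary_sum b"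
    unfolding ternary_sum_def by (rule suminf_nonneg[OF summable_ternary]) auto
  have "ternary_sum b \<le> (\<Sum>m. (1/3) ^ m)"
    unfolding ternary_sum_def by (rule suminf_le[OF _ summable_ternary summable_geometric]) auto
  then show "ternary_sum b \<le> 3/2" by (simp add: suminf_geometric)
qed

lemma ternary_sum_ge_1_iff: "1 \<le> ternary_sum b \<longleftrightarrow> b 0"
proof -
  note bounds = ternary_sum_bounds[of "b \<circ> Suc"] and tail = ternary_sum_tail[of b]
  show ?thesis
  proof (cases "b 0")
    case True
    then have "ternary_sum b = 1 + ternary_sum (b \<circ> Suc) / 3" using tail by (simp del: o_apply)
    with bounds True show ?thesis by linarith
  next
    case False
    then have "ternary_sum b = ternary_sum (b \<circ> Suc) / 3" using tail by (simp del: o_apply)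
    with bounds False show ?thesis by linarith
  qed
qed

lemma ternary_shift_sum: "ternary_shift (ternary_sum b) = ternary_sum (b \<circ> Suc)"
  unfolding ternary_shift_def ternary_sum_ge_1_iff by (subst ternary_sum_tail) simp

text \<open>Every digit is thus a Borel function of the sum, which makes decoding
  measurable.\<close>

lemma ternary_digit: "1 \<le> (ternary_shift ^^ m) (ternary_sum b) \<longleftrightarrow> b m"
proof (induction m arbitrary: b)
  case (Suc m)
  have "(ternary_shift ^^ Suc m) (ternary_sum b) = (ternary_shift ^^ m) (ternary_sum (b \<circ> Suc))"
    by (simp add: funpow_Suc_right ternary_shift_sum del: funpow.simps)
  then show ?case by (simp only: Suc) simp
qed (simp add: ternary_sum_ge_1_iff)

lemma dense_sequence:
  obtains p :: "nat \<Rightarrow> 'a::polish_space" where "\<And>x r. 0 < r \<Longrightarrow> \<exists>k. dist x (p k) < r"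
proof -
  obtain D :: "'a set" where D: "countable D" "\<And>X. open X \<Longrightarrow> X \<noteq> {} \<Longrightarrow> \<exists>d\<in>D. d \<in> X"
    by (rule countable_dense_setE) blast
  have "\<exists>k. dist x (from_nat_into D k) < r" if r: "0 < r" for x r
  proof -
    obtain y where "y \<in> D" "dist x y < r" using D(2)[of "ball x r"] r by (auto simp: not_le)
    then show ?thesis using from_nat_into_surj[OF D(1), of y] by auto
  qed
  then show ?thesis by (rule that)
qed

text \<open>The digits of \<open>e x\<close> record which points \<open>p k\<close> of a dense
  sequence lie within \<open>(1/2) ^ n\<close> of \<open>x\<close>. From them \<open>near\<close>
  reads, for each \<open>n\<close>, the first such point; these points converge to \<open>x\<close>,
  and \<open>d\<close> takes their limit.\<close>

lemma polish_borel_embedding: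
  obtains e :: "'a::polish_space \<Rightarrow> real" and d :: "real \<Rightarrow> 'a"
  where "e \<in> borel_measurable borel" "d \<in> borel_measurable borel" "\<And>x. d (e x) = x"
proof -
  obtain p :: "nat \<Rightarrow> 'a" where p: "\<And>x r. 0 < r \<Longrightarrow> \<exists>k. dist x (p k) < r"
    by (rule dense_sequence) blast
  define e where "e x = ternary_sum (\<lambda>m. case prod_decode m of (n, k) \<Rightarrow> dist x (p k) < (1/2) ^ n)" for x
  define near where "near n s = (LEAST k. 1 \<le> (ternary_shift ^^ prod_encode (n, k)) s)" for n :: nat and s :: real
  \<comment> \<open>A real number need not encode a point, so a default covers sequences that are
    not Cauchy.\<close>
  define d where "d s = (if Cauchy (\<lambda>n. p (near n s)) then lim (\<lambda>n. p (near n s)) else p 0)" for s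
  have [measurable]: "ternary_shift \<in> borel_measurable borel"
    unfolding ternary_shift_def [abs_def] by measurable
  have [measurable]: "(ternary_shift ^^ m) \<in> borel_measurable borel" for m
  proof (induction m)
    case (Suc m)
    have [measurable]: "(ternary_shift ^^ m) \<in> borel_measurable borel" by (rule Suc)
    show ?case unfolding funpow.simps by measurable
  qed simp
  have [measurable]: "near n \<in> measurable borel (count_space UNIV)" for n
    unfolding near_def by measurable
  have "d \<in> borel_measurable borel"
    unfolding d_def by (rule borel_measurable_lim_Cauchy) measurable
  moreover have "e \<in> borel_measurable borel"
    unfolding e_def ternary_sum_def
    by (intro borel_measurable_suminf borel_measurable_times) (auto split: prod.split)
  moreover have "d (e x) = x" for x
  proof -
    have "dist x (p (near n (e x))) < (1/2) ^ n" for n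
    proof -
      have "near n (e x) = (LEAST k. dist x (p k) < (1/2) ^ n)"
        by (simp add: near_def e_def ternary_digit)
      then show ?thesis using p[of "(1/2) ^ n" x] by (auto intro: LeastI)
    qed
    then have bound: "\<forall>n. norm (dist (p (near n (e x))) x) \<le> (1/2) ^ n"
      by (simp add: dist_commute less_imp_le)
    have "(\<lambda>n. (1/2) ^ n :: real) \<longlonglongrightarrow> 0"
      by (rule LIMSEQ_realpow_zero) simp_all
    then have "(\<lambda>n. dist (p (near n (e x))) x) \<longlonglongrightarrow> 0"
      by (rule Lim_null_comparison[OF always_eventually[OF bound]])
    then have "(\<lambda>n. p (near n (e x))) \<longlonglongrightarrow> x" by (rule tendsto_dist_iff[THEN iffD2])
    then show ?thesis by (simp add: d_def LIMSEQ_imp_Cauchy limI)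
  qed
  ultimately show ?thesis using that by blast
qed

section \<open>Variables with prescribed laws on atomless spaces\<close>

lemma atomless_representation:
  fixes \<mu> :: "'a::polish_space measure"
  assumes "real_distribution M" and atomless: "\<And>x. measure M {x} = 0"
    and "prob_space \<mu>" "sets \<mu> = sets borel"
  obtains X where "X \<in> borel_measurable borel" "distr M borel X = \<mu>"
proof -
  obtain e :: "'a \<Rightarrow> real" and d where ed [measurable]: "e \<in> borel_measurable borel"
      "d \<in> borel_measurable borel" and de: "\<And>x. d (e x) = x"
    by (rule polish_borel_embedding) blast
  interpret M: cdf_distribution M using assms(1) by (simp add: cdf_distribution_def)
  interpret \<mu>: prob_space \<mu> by fact
  note [measurable_cong] = assms(4)
  have "real_distribution (distr \<mu> borel e)"
    by (intro \<mu>.real_distribution_distr) simp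
  then interpret N: cdf_distribution "distr \<mu> borel e" by (simp add: cdf_distribution_def)
  \<comment> \<open>The distribution function makes \<open>M\<close> uniform, the quantile function
    turns this into the law of \<open>e\<close> under \<open>\<mu>\<close>, and \<open>d\<close>
    decodes it.\<close>
  have "distr M borel (d \<circ> (N.quantile \<circ> M.C)) = distr (distr (distr M borel M.C) borel N.quantile) borel d"
    by (simp add: distr_distr comp_assoc)
  also have "\<dots> = distr \<mu> borel (\<lambda>x. x)"
    by (simp add: M.distr_cdf[OF atomless] N.distr_quantile distr_distr comp_def de)
  also have "\<dots> = \<mu>" by (rule distr_id2) (simp add: assms(4))
  finally have "distr M borel (d \<circ> (N.quantile \<circ> M.C)) = \<mu>" .
  moreover have "d \<circ> (N.quantile \<circ> M.C) \<in> borel_measurable borel"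
    by (intro measurable_comp[of _ borel borel]) simp_all
  ultimately show ?thesis by (intro that)
qed

text \<open>Conditioning on an event of positive probability leaves single points null, so the
  atomless case applies.\<close>

lemma unit_prob_representation:
  fixes \<mu> :: "'a::polish_space measure"
  assumes "prob_space \<mu>" "sets \<mu> = sets borel" "A \<in> sets borel" "emeasure unit_prob A \<noteq> 0"
  obtains X where "X \<in> borel_measurable borel" "distr (uniform_measure unit_prob A) borel X = \<mu>"
proof (rule atomless_representation[OF _ _ assms(1,2)])
  let ?M = "uniform_measure unit_prob A"
  show "real_distribution ?M"
    using assms unfolding real_distribution_def real_distribution_axioms_def
    by (auto intro!: prob_space_uniform_measure simp: unit_prob.emeasure_eq_measure)
  have "emeasure unit_prob (A \<inter> {x}) \<le> emeasure unit_prob {x}" for x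
    by (rule emeasure_mono) auto
  then have "emeasure ?M {x} = 0" for x
    using assms by (simp add: unit_prob_singleton ennreal_zero_divide)
  then show "measure ?M {x} = 0" for x by (simp add: measure_def)
qed (use assms that in auto)

text \<open>Conditionally on \<open>J = i\<close>, the space \<open>unit_prob\<close> is still atomless and carries a variable with
  any prescribed law.  This replaces the gluing lemma and its disintegration of measures.\<close>

lemma discrete_transfer:
  fixes J :: "real \<Rightarrow> nat" and x :: "'b \<Rightarrow> 'a::polish_space"
  assumes "prob_space N"
    and [measurable]: "J \<in> measurable borel (count_space UNIV)"
      "j \<in> measurable N (count_space UNIV)" "x \<in> borel_measurable N"
    and law: "distr unit_prob (count_space UNIV) J = distr N (count_space UNIV) j"
  obtains X where "X \<in> borel_measurable borel"
    "distr unit_prob (count_space UNIV \<Otimes>\<^sub>M borel) (\<lambda>u. (J u, X u)) =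
     distr N (count_space UNIV \<Otimes>\<^sub>M borel) (\<lambda>b. (j b, x b))"
proof -
  interpret N: prob_space N by fact
  have p: "emeasure unit_prob {u. J u = i} = emeasure N {b \<in> space N. j b = i}" for i
  proof -
    have "emeasure (distr unit_prob (count_space UNIV) J) {i} = emeasure (distr N (count_space UNIV) j) {i}"
      by (simp add: law)
    then show ?thesis
      by (simp add: emeasure_distr vimage_def Int_def conj_commute)
  qed
  \<comment> \<open>On each event \<open>J = i\<close> only the conditional law of \<open>x\<close>
    given \<open>j = i\<close> has to be reproduced; on a null event any constant will do.\<close>
  have "\<exists>X. X \<in> borel_measurable borel \<and> (\<forall>B\<in>sets borel.
      emeasure unit_prob {u. J u = i \<and> X u \<in> B} = emeasure N {b \<in> space N. j b = i \<and> x b \<in> B})" for i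
  proof (cases "emeasure unit_prob {u. J u = i} = 0")
    case True
    have "emeasure unit_prob {u. J u = i \<and> y \<in> B} = emeasure N {b \<in> space N. j b = i \<and> x b \<in> B}"
      if "B \<in> sets borel" for y :: 'a and B
    proof -
      have "emeasure unit_prob {u. J u = i \<and> y \<in> B} \<le> emeasure unit_prob {u. J u = i}"
        by (rule emeasure_mono) auto
      moreover have "emeasure N {b \<in> space N. j b = i \<and> x b \<in> B} \<le> emeasure N {b \<in> space N. j b = i}"
        by (rule emeasure_mono) auto
      ultimately show ?thesis using True p[of i] by simp
    qed
    then show ?thesis by (intro exI[of _ "\<lambda>_. undefined"]) auto
  next
    case False
    define p where "p = emeasure unit_prob {u. J u = i}"
    have pN: "emeasure N {b \<in> space N. j b = i} = p" and "p \<noteq> 0" "p \<noteq> \<infinity>"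
      using p False by (auto simp: p_def unit_prob.emeasure_eq_measure)
    let ?N = "uniform_measure N {b \<in> space N. j b = i}"
    have "prob_space ?N"
      using pN \<open>p \<noteq> 0\<close> \<open>p \<noteq> \<infinity>\<close> by (intro prob_space_uniform_measure) auto
    then have "prob_space (distr ?N borel x)"
      by (rule prob_space.prob_space_distr) simp
    then obtain X where X [measurable]: "X \<in> borel_measurable borel"
      and eq: "distr (uniform_measure unit_prob {u. J u = i}) borel X = distr ?N borel x"
      by (rule unit_prob_representation[of _ "{u. J u = i}"]) (use False in auto)
    have "emeasure unit_prob {u. J u = i \<and> X u \<in> B} = emeasure N {b \<in> space N. j b = i \<and> x b \<in> B}"
      if [measurable]: "B \<in> sets borel" for B
    proof -
      have "emeasure (distr (uniform_measure unit_prob {u. J u = i}) borel X) B =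
        emeasure unit_prob {u. J u = i \<and> X u \<in> B} / p"
        by (simp add: emeasure_distr p_def Int_def)
      moreover have "emeasure (distr ?N borel x) B = emeasure N {b \<in> space N. j b = i \<and> x b \<in> B} / p"
      proof -
        have "x -` B \<inter> space N \<in> sets N"
          "{b \<in> space N. j b = i} \<inter> (x -` B \<inter> space N) = {b \<in> space N. j b = i \<and> x b \<in> B}"
          by (auto intro: measurable_sets)
        then show ?thesis by (simp add: emeasure_distr pN)
      qed
      \<comment> \<open>Both conditional laws carry the same normalisation \<open>p\<close>, which
        cancels because it is neither 0 nor infinite.\<close>
      ultimately have "emeasure unit_prob {u. J u = i \<and> X u \<in> B} / p * p =
          emeasure N {b \<in> space N. j b = i \<and> x b \<in> B} / p * p"
        by (simp add: eq)
      then show ?thesis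
        using \<open>p \<noteq> 0\<close> \<open>p \<noteq> \<infinity>\<close> by (simp add: ennreal_divide_times less_top)
    qed
    with X show ?thesis by blast
  qed
  then have "\<exists>Y. \<forall>i. Y i \<in> borel_measurable borel \<and> (\<forall>B\<in>sets borel.
      emeasure unit_prob {u. J u = i \<and> Y i u \<in> B} = emeasure N {b \<in> space N. j b = i \<and> x b \<in> B})"
    by (intro choice allI)
  then obtain Y where [measurable]: "\<And>i. Y i \<in> borel_measurable borel"
    and Y: "\<And>i B. B \<in> sets borel \<Longrightarrow>
      emeasure unit_prob {u. J u = i \<and> Y i u \<in> B} = emeasure N {b \<in> space N. j b = i \<and> x b \<in> B}"
    by blast
  define X where "X u = Y (J u) u" for u
  have X [measurable]: "X \<in> borel_measurable borel"
    unfolding X_def by measurable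
  have "distr unit_prob (count_space UNIV \<Otimes>\<^sub>M borel) (\<lambda>u. (J u, X u)) =
     distr N (count_space UNIV \<Otimes>\<^sub>M borel) (\<lambda>b. (j b, x b))" (is "?L = ?R")
  proof (rule measure_eqI)
    fix A assume "A \<in> sets ?L"
    then have [measurable]: "A \<in> sets (count_space UNIV \<Otimes>\<^sub>M borel)" by simp
    have slice [measurable]: "Pair i -` A \<in> sets borel" for i
      by (rule sets_Pair1) fact
    \<comment> \<open>Countably many slices exhaust \<open>A\<close>, so equality on each event
      \<open>J = i\<close> suffices.\<close>
    have "emeasure ?L A = emeasure unit_prob (\<Union>i. {u. J u = i \<and> X u \<in> Pair i -` A})"
      by (simp add: emeasure_distr) (auto intro!: arg_cong[where f="emeasure unit_prob"])
    also have "\<dots> = (\<Sum>i. emeasure unit_prob {u. J u = i \<and> X u \<in> Pair i -` A})"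
      by (rule suminf_emeasure[symmetric]) (auto simp: disjoint_family_on_def)
    also have "\<dots> = (\<Sum>i. emeasure unit_prob {u. J u = i \<and> Y i u \<in> Pair i -` A})"
      by (intro suminf_cong arg_cong[where f="emeasure unit_prob"]) (auto simp: X_def)
    also have "\<dots> = (\<Sum>i. emeasure N {b \<in> space N. j b = i \<and> x b \<in> Pair i -` A})"
      by (simp only: Y[OF slice])
    also have "\<dots> = emeasure N (\<Union>i. {b \<in> space N. j b = i \<and> x b \<in> Pair i -` A})"
      by (rule suminf_emeasure) (auto simp: disjoint_family_on_def)
    also have "\<dots> = emeasure ?R A"
      by (simp add: emeasure_distr) (auto intro!: arg_cong[where f="emeasure N"])
    finally show "emeasure ?L A = emeasure ?R A" .
  qed simp
  with X show ?thesis by (rule that)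
qed

text \<open>A cell consists of the points with the same first close centre in a dense sequence;
  being countably many, the cells let \<open>discrete_transfer\<close> act on their indices.\<close>

lemma fine_partition:
  fixes e :: real assumes "0 < e"
  obtains i :: "'a::polish_space \<Rightarrow> nat" and c :: "nat \<Rightarrow> 'a"
  where "i \<in> measurable borel (count_space UNIV)" "\<And>y. dist y (c (i y)) < e"
proof -
  obtain c :: "nat \<Rightarrow> 'a" where c: "\<And>x r. 0 < r \<Longrightarrow> \<exists>k. dist x (c k) < r"
    by (rule dense_sequence) blast
  define i where "i y = (LEAST k. dist y (c k) < e)" for y
  have "i \<in> measurable borel (count_space UNIV)"
    unfolding i_def by measurable
  moreover have "dist y (c (i y)) < e" for y
    unfolding i_def using c[OF assms] by (rule LeastI_ex)
  ultimately show ?thesis by (rule that)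
qed

section \<open>The Hilbert space of square-integrable random variables\<close>

definition square_integrable :: "(real \<Rightarrow> 'a::{real_inner, polish_space}) \<Rightarrow> bool" where
  "square_integrable f \<longleftrightarrow> f \<in> borel_measurable borel \<and> integrable unit_prob (\<lambda>u. (norm (f u))\<^sup>2)"

lemma square_integrableD [measurable_dest]: "square_integrable f \<Longrightarrow> f \<in> borel_measurable borel"
  by (simp add: square_integrable_def)

lemma integrable_inner:
  fixes f g :: "'b \<Rightarrow> 'a::{real_inner, second_countable_topology}"
  assumes [measurable]: "f \<in> borel_measurable M" "g \<in> borel_measurable M"
    and "integrable M (\<lambda>u. (norm (f u))\<^sup>2)" "integrable M (\<lambda>u. (norm (g u))\<^sup>2)"
  shows "integrable M (\<lambda>u. f u \<bullet> g u)"
proof (rule Bochner_Integration.integrable_bound)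
  show "integrable M (\<lambda>u. (norm (f u))\<^sup>2 + (norm (g u))\<^sup>2)"
    using assms by auto
  have "norm (f u \<bullet> g u) \<le> norm ((norm (f u))\<^sup>2 + (norm (g u))\<^sup>2)" for u
  proof -
    have "\<bar>f u \<bullet> g u\<bar> \<le> norm (f u) * norm (g u)" by (rule Cauchy_Schwarz_ineq2)
    also have "\<dots> \<le> (norm (f u))\<^sup>2 + (norm (g u))\<^sup>2"
      using sum_squares_bound[of "norm (f u)" "norm (g u)"] by (simp add: mult.assoc)
        (metis (no_types, lifting) add_increasing2 le_add_same_cancel1 mult_2 mult_nonneg_nonneg norm_ge_zero order_trans)
    finally show ?thesis by simp
  qed
  then show "AE u in M. norm (f u \<bullet> g u) \<le> norm ((norm (f u))\<^sup>2 + (norm (g u))\<^sup>2)" by simp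
qed simp

lemma square_integrable_inner:
  "square_integrable f \<Longrightarrow> square_integrable g \<Longrightarrow> integrable unit_prob (\<lambda>u. f u \<bullet> g u)"
  by (rule integrable_inner) (auto simp: square_integrable_def)

lemma square_integrable_scaleR: "square_integrable f \<Longrightarrow> square_integrable (\<lambda>u. c *\<^sub>R f u)"
  by (auto simp: square_integrable_def power_mult_distrib)

lemma square_integrable_add:
  assumes "square_integrable f" "square_integrable g"
  shows "square_integrable (\<lambda>u. f u + g u)"
proof -
  have "integrable unit_prob (\<lambda>u. f u \<bullet> f u + 2 * (f u \<bullet> g u) + g u \<bullet> g u)"
    using assms by (intro Bochner_Integration.integrable_add integrable_mult_right square_integrable_inner)
  then show ?thesis
    using assms by (auto simp: square_integrable_def power2_norm_eq_inner inner_add inner_commute algebra_simps)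
qed

lemma square_integrable_uminus: "square_integrable f \<Longrightarrow> square_integrable (\<lambda>u. - f u)"
  using square_integrable_scaleR[of f "- 1"] by simp

lemma square_integrable_diff:
  "square_integrable f \<Longrightarrow> square_integrable g \<Longrightarrow> square_integrable (\<lambda>u. f u - g u)"
  using square_integrable_add[of f "\<lambda>u. - g u"] square_integrable_uminus[of g] by simp

lemma square_integrable_zero: "square_integrable (\<lambda>u. 0)"
  by (simp add: square_integrable_def)

text \<open>Square integrability is built into the relation, so it is a partial equivalence whose
  quotient is the usual space of almost-everywhere classes.\<close>

definition L2_rel :: "(real \<Rightarrow> 'a::{real_inner, polish_space}) \<Rightarrow> (real \<Rightarrow> 'a) \<Rightarrow> bool" where
  "L2_rel f g \<longleftrightarrow> square_integrable f \<and> square_integrable g \<and> (AE u in unit_prob. f u = g u)"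

lemma L2_relI:
  "square_integrable f \<Longrightarrow> square_integrable g \<Longrightarrow> (AE u in unit_prob. f u = g u) \<Longrightarrow> L2_rel f g"
  by (simp add: L2_rel_def)

lemma part_equivp_L2_rel:
  "part_equivp (L2_rel :: (real \<Rightarrow> 'a::{real_inner, polish_space}) \<Rightarrow> _)" (is "part_equivp ?R")
proof (rule part_equivpI)
  have "?R (\<lambda>u. 0) (\<lambda>u. 0)" by (simp add: L2_rel_def square_integrable_zero)
  then show "\<exists>f. ?R f f" by (rule exI[of _ "\<lambda>u. 0"])
  show "symp ?R" by (auto simp: L2_rel_def symp_def)
  show "transp ?R"
    unfolding transp_def L2_rel_def
  proof (intro allI impI conjI)
    fix f g h :: "real \<Rightarrow> 'a"
    assume fg: "square_integrable f \<and> square_integrable g \<and> (AE u in unit_prob. f u = g u)"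
      and gh: "square_integrable g \<and> square_integrable h \<and> (AE u in unit_prob. g u = h u)"
    from fg gh have "AE u in unit_prob. f u = g u" "AE u in unit_prob. g u = h u" by auto
    then show "AE u in unit_prob. f u = h u" by eventually_elim simp
  qed auto
qed

quotient_type (overloaded) 'a L2 = "real \<Rightarrow> 'a::{real_inner, polish_space}" / partial: L2_rel
  by (rule part_equivp_L2_rel)

instantiation L2 :: ("{real_inner, polish_space}") real_inner
begin

lift_definition zero_L2 :: "'a L2" is "\<lambda>u. 0"
  by (simp add: L2_rel_def square_integrable_zero)

lift_definition plus_L2 :: "'a L2 \<Rightarrow> 'a L2 \<Rightarrow> 'a L2" is "\<lambda>f g u. f u + g u"
  by (auto simp: L2_rel_def intro: square_integrable_add)

lift_definition minus_L2 :: "'a L2 \<Rightarrow> 'a L2 \<Rightarrow> 'a L2" is "\<lambda>f g u. f u - g u"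
  by (auto simp: L2_rel_def intro: square_integrable_diff)

lift_definition uminus_L2 :: "'a L2 \<Rightarrow> 'a L2" is "\<lambda>f u. - f u"
  by (auto simp: L2_rel_def intro: square_integrable_uminus)

lift_definition scaleR_L2 :: "real \<Rightarrow> 'a L2 \<Rightarrow> 'a L2" is "\<lambda>c f u. c *\<^sub>R f u"
  by (auto simp: L2_rel_def intro: square_integrable_scaleR)

lift_definition inner_L2 :: "'a L2 \<Rightarrow> 'a L2 \<Rightarrow> real" is "\<lambda>f g. LINT u|unit_prob. f u \<bullet> g u"
proof -
  fix f f' g g' :: "real \<Rightarrow> 'a"
  assume *: "L2_rel f f'" "L2_rel g g'"
  then have [measurable]: "f \<in> borel_measurable borel" "f' \<in> borel_measurable borel"
    "g \<in> borel_measurable borel" "g' \<in> borel_measurable borel"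
    by (auto simp: L2_rel_def square_integrableD)
  from * have "AE u in unit_prob. f u = f' u" "AE u in unit_prob. g u = g' u"
    by (auto simp: L2_rel_def)
  then have "AE u in unit_prob. f u \<bullet> g u = f' u \<bullet> g' u" by eventually_elim simp
  then show "(LINT u|unit_prob. f u \<bullet> g u) = (LINT u|unit_prob. f' u \<bullet> g' u)"
    by (intro integral_cong_AE) auto
qed

definition norm_L2 :: "'a L2 \<Rightarrow> real" where "norm_L2 X = sqrt (X \<bullet> X)"
definition sgn_L2 :: "'a L2 \<Rightarrow> 'a L2" where "sgn_L2 X = scaleR (inverse (norm X)) X"
definition dist_L2 :: "'a L2 \<Rightarrow> 'a L2 \<Rightarrow> real" where "dist_L2 X Y = norm (X - Y)"
definition uniformity_L2 :: "('a L2 \<times> 'a L2) filter" where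
  "uniformity_L2 = (INF e\<in>{0 <..}. principal {(X, Y). dist X Y < e})"
definition open_L2 :: "'a L2 set \<Rightarrow> bool" where
  "open_L2 S = (\<forall>X\<in>S. \<forall>\<^sub>F (X', Y) in uniformity. X' = X \<longrightarrow> Y \<in> S)"

instance
proof
  fix X Y Z :: "'a L2" and a b :: real
  show "X + Y + Z = X + (Y + Z)"
    by transfer (auto intro!: L2_relI square_integrable_add simp: L2_rel_def algebra_simps)
  show "X + Y = Y + X"
    by transfer (auto intro!: L2_relI square_integrable_add simp: L2_rel_def algebra_simps)
  show "0 + X = X"
    by transfer (auto simp: L2_rel_def)
  show "- X + X = 0"
    by transfer (auto simp: L2_rel_def square_integrable_zero)
  show "X - Y = X + - Y"
    by transfer (auto intro!: L2_relI square_integrable_diff simp: L2_rel_def)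
  show "a *\<^sub>R (X + Y) = a *\<^sub>R X + a *\<^sub>R Y"
    by transfer (auto intro!: L2_relI square_integrable_add square_integrable_scaleR simp: L2_rel_def scaleR_add_right)
  show "(a + b) *\<^sub>R X = a *\<^sub>R X + b *\<^sub>R X"
    by transfer (auto intro!: L2_relI square_integrable_add square_integrable_scaleR simp: L2_rel_def scaleR_add_left)
  show "a *\<^sub>R b *\<^sub>R X = (a * b) *\<^sub>R X"
    by transfer (auto intro!: L2_relI square_integrable_scaleR simp: L2_rel_def)
  show "1 *\<^sub>R X = X"
    by transfer (auto simp: L2_rel_def)
  show "X \<bullet> Y = Y \<bullet> X"
    by transfer (simp add: inner_commute)
  show "(X + Y) \<bullet> Z = X \<bullet> Z + Y \<bullet> Z"
    by transfer (simp add: inner_add_left square_integrable_inner L2_rel_def)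
  show "a *\<^sub>R X \<bullet> Y = a * (X \<bullet> Y)"
    by transfer simp
  show "0 \<le> X \<bullet> X"
    by transfer simp
  show "X \<bullet> X = 0 \<longleftrightarrow> X = 0"
  proof transfer
    fix f :: "real \<Rightarrow> 'a" assume "L2_rel f f"
    then have f: "square_integrable f" by (simp add: L2_rel_def)
    have "(LINT u|unit_prob. f u \<bullet> f u) = 0 \<longleftrightarrow> (AE u in unit_prob. f u \<bullet> f u = 0)"
      by (rule integral_nonneg_eq_0_iff_AE) (auto intro: square_integrable_inner f)
    then show "((LINT u|unit_prob. f u \<bullet> f u) = 0) = L2_rel f (\<lambda>u. 0)"
      using f by (simp add: L2_rel_def square_integrable_zero)
  qed
qed (simp_all add: norm_L2_def sgn_L2_def dist_L2_def uniformity_L2_def open_L2_def)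

end

text \<open>A chosen representative of the class, so identities between representatives hold only
  almost everywhere.\<close>

definition L2_fun :: "'a::{real_inner, polish_space} L2 \<Rightarrow> real \<Rightarrow> 'a" where
  "L2_fun = rep_L2"

definition L2_class :: "(real \<Rightarrow> 'a::{real_inner, polish_space}) \<Rightarrow> 'a L2" where
  "L2_class = abs_L2"

lemma square_integrable_L2_fun [simp]: "square_integrable (L2_fun X)"
  using Quotient3_rep_reflp[OF Quotient3_L2, of X] by (simp add: L2_rel_def L2_fun_def)

lemma measurable_L2_fun [measurable]: "L2_fun X \<in> borel_measurable borel"
  by (rule square_integrableD) simp

lemma L2_fun_class: "square_integrable f \<Longrightarrow> AE u in unit_prob. L2_fun (L2_class f) u = f u"
  using Quotient3_rep_abs[OF Quotient3_L2, of f] by (simp add: L2_rel_def L2_fun_def L2_class_def)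

lemma L2_fun_add: "AE u in unit_prob. L2_fun (X + Y) u = L2_fun X u + L2_fun Y u"
  using L2_fun_class[OF square_integrable_add[OF square_integrable_L2_fun[of X] square_integrable_L2_fun[of Y]]]
  by (simp add: plus_L2_def L2_fun_def L2_class_def)

lemma L2_fun_diff: "AE u in unit_prob. L2_fun (X - Y) u = L2_fun X u - L2_fun Y u"
  using L2_fun_class[OF square_integrable_diff[OF square_integrable_L2_fun[of X] square_integrable_L2_fun[of Y]]]
  by (simp add: minus_L2_def L2_fun_def L2_class_def)

lemma L2_fun_scaleR: "AE u in unit_prob. L2_fun (c *\<^sub>R X) u = c *\<^sub>R L2_fun X u"
  using L2_fun_class[OF square_integrable_scaleR[OF square_integrable_L2_fun[of X]]]
  by (simp add: scaleR_L2_def L2_fun_def L2_class_def)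

lemma inner_L2_eq: "X \<bullet> Y = (LINT u|unit_prob. L2_fun X u \<bullet> L2_fun Y u)"
  by (simp add: inner_L2_def L2_fun_def)

lemma norm_L2_eq: "(norm X)\<^sup>2 = (LINT u|unit_prob. (norm (L2_fun X u))\<^sup>2)"
  by (simp add: power2_norm_eq_inner inner_L2_eq)

lemma norm_diff_L2_eq: "(norm (X - Y))\<^sup>2 = (LINT u|unit_prob. (norm (L2_fun X u - L2_fun Y u))\<^sup>2)"
  unfolding norm_L2_eq using L2_fun_diff[of X Y] by (intro integral_cong_AE) auto

section \<open>Completeness of \<open>L2\<close>\<close>

lemma summable_dist_imp_Cauchy:
  fixes s :: "nat \<Rightarrow> 'a::metric_space"
  assumes "summable (\<lambda>k. dist (s k) (s (Suc k)))"
  shows "Cauchy s"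
proof (rule metric_CauchyI)
  define T where "T n = (\<Sum>k<n. dist (s k) (s (Suc k)))" for n
  \<comment> \<open>Distances are bounded by increments of the partial sums \<open>T\<close>, which
    converge.\<close>
  have le: "dist (s m) (s (m + n)) \<le> T (m + n) - T m" for m n
  proof (induction n)
    case (Suc n)
    have "dist (s m) (s (m + Suc n)) \<le> dist (s m) (s (m + n)) + dist (s (m + n)) (s (Suc (m + n)))"
      using dist_triangle[of "s m" "s (Suc (m + n))" "s (m + n)"] by simp
    with Suc show ?case by (simp add: T_def)
  qed simp
  fix e :: real assume "0 < e"
  have "convergent T" using assms by (simp add: T_def [abs_def] summable_iff_convergent)
  then have "Cauchy T" by (rule convergent_Cauchy)
  then obtain M where M: "\<And>m n. M \<le> m \<Longrightarrow> M \<le> n \<Longrightarrow> dist (T m) (T n) < e"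
    using metric_CauchyD[OF _ \<open>0 < e\<close>] by blast
  have "dist (s m) (s n) < e" if "M \<le> m" "m \<le> n" for m n
    using le[of m "n - m"] M[of m n] that by (auto simp: dist_real_def)
  then show "\<exists>M. \<forall>m\<ge>M. \<forall>n\<ge>M. dist (s m) (s n) < e"
    by (metis dist_commute linear)
qed

text \<open>Riesz-Fischer: along a subsequence with steps at most \<open>(1/2) ^ k\<close> the
  pointwise distances are almost surely summable, so the representatives converge almost everywhere;
  Fatou's lemma then bounds the distance to the limit.\<close>

instance L2 :: ("{real_inner, polish_space}") complete_space
proof
  fix X :: "nat \<Rightarrow> 'a L2" assume "Cauchy X"
  then have "\<exists>M. \<forall>m\<ge>M. \<forall>n\<ge>M. dist (X m) (X n) < (1/2) ^ k" for k :: nat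
    by (intro metric_CauchyD) auto
  then have "\<exists>M. \<forall>k. \<forall>m\<ge>M k. \<forall>n\<ge>M k. dist (X m) (X n) < (1/2) ^ k"
    by (intro choice allI)
  then obtain M where M: "\<And>k m n. M k \<le> m \<Longrightarrow> M k \<le> n \<Longrightarrow> norm (X m - X n) < (1/2) ^ k"
    by (auto simp: dist_norm)
  \<comment> \<open>Partial sums dominate all earlier \<open>M i\<close>, so \<open>r j\<close>
    meets the accuracy \<open>(1/2) ^ k\<close> for every \<open>k \<le> j\<close>.\<close>
  define r where "r k = (\<Sum>i\<le>k. M i)" for k
  have r: "M k \<le> r j" if "k \<le> j" for k j
    unfolding r_def by (rule member_le_sum) (use that in auto)
  define g where "g k = L2_fun (X (r k))" for k
  have [measurable]: "g k \<in> borel_measurable borel" for k unfolding g_def by simp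
  have E: "(\<integral>\<^sup>+u. ennreal (dist (g k u) (g (Suc k) u)) \<partial>unit_prob) \<le> ennreal ((1/2) ^ k)" for k
  proof -
    define c :: real where "c = (1/2) ^ k"
    have "0 < c" by (simp add: c_def)
    let ?d = "\<lambda>u. norm (g k u - g (Suc k) u)"
    have int: "integrable unit_prob (\<lambda>u. (?d u)\<^sup>2)"
      using square_integrable_diff[OF square_integrable_L2_fun square_integrable_L2_fun]
      unfolding g_def square_integrable_def by blast
    have "norm (X (r k) - X (r (Suc k))) \<le> c"
      unfolding c_def using M[of k "r k" "r (Suc k)"] r by simp
    then have bound: "(LINT u|unit_prob. (?d u)\<^sup>2) \<le> c\<^sup>2"
      unfolding g_def norm_diff_L2_eq[symmetric] by (intro power_mono) auto
    \<comment> \<open>Young's inequality with weight \<open>c\<close>: integrated against the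
      \<open>L2\<close> bound \<open>c\<close>, it yields an \<open>L1\<close> bound by the same
      \<open>c\<close>.\<close>
    have "dist (g k u) (g (Suc k) u) \<le> c / 2 + (?d u)\<^sup>2 / (2 * c)" for u
    proof -
      have "2 * c * ?d u \<le> c\<^sup>2 + (?d u)\<^sup>2" using sum_squares_bound[of c "?d u"] by simp
      then show ?thesis using \<open>0 < c\<close> by (simp add: dist_norm field_simps power2_eq_square)
    qed
    then have "(\<integral>\<^sup>+u. ennreal (dist (g k u) (g (Suc k) u)) \<partial>unit_prob) \<le>
        (\<integral>\<^sup>+u. ennreal (c / 2 + (?d u)\<^sup>2 / (2 * c)) \<partial>unit_prob)"
      by (intro nn_integral_mono ennreal_leI) auto
    also have "\<dots> = ennreal (LINT u|unit_prob. c / 2 + (?d u)\<^sup>2 / (2 * c))"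
      using int \<open>0 < c\<close> by (intro nn_integral_eq_integral) auto
    also have "(LINT u|unit_prob. c / 2 + (?d u)\<^sup>2 / (2 * c)) = c / 2 + (LINT u|unit_prob. (?d u)\<^sup>2) / (2 * c)"
      using int unit_prob.prob_space by simp
    also have "\<dots> \<le> c / 2 + c\<^sup>2 / (2 * c)"
      using bound \<open>0 < c\<close> by (intro add_left_mono divide_right_mono) auto
    also have "\<dots> = c" using \<open>0 < c\<close> by (simp add: power2_eq_square)
    finally show ?thesis unfolding c_def by (simp add: ennreal_leI)
  qed
  have "(\<integral>\<^sup>+u. (\<Sum>k. ennreal (dist (g k u) (g (Suc k) u))) \<partial>unit_prob) \<le> (\<Sum>k. ennreal ((1/2) ^ k))"
    by (subst nn_integral_suminf) (auto intro!: suminf_le E)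
  also have "\<dots> = ennreal (\<Sum>k. (1/2) ^ k)"
    by (rule suminf_ennreal2) auto
  also have "\<dots> < \<infinity>" by simp
  finally have "AE u in unit_prob. (\<Sum>k. ennreal (dist (g k u) (g (Suc k) u))) \<noteq> \<infinity>"
    by (intro nn_integral_PInf_AE) auto
  then have Cauchy_g: "AE u in unit_prob. Cauchy (\<lambda>k. g k u)"
    by eventually_elim (auto intro!: summable_dist_imp_Cauchy summable_suminf_not_top)
  define f where "f u = (if Cauchy (\<lambda>k. g k u) then lim (\<lambda>k. g k u) else 0)" for u
  have [measurable]: "f \<in> borel_measurable borel"
    unfolding f_def by (rule borel_measurable_lim_Cauchy) auto
  have lim_g: "AE u in unit_prob. (\<lambda>k. g k u) \<longlonglongrightarrow> f u"
    using Cauchy_g by eventually_elim (simp add: f_def Cauchy_convergent_iff convergent_LIMSEQ_iff)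
  have F: "(\<integral>\<^sup>+u. ennreal ((norm (L2_fun (X n) u - f u))\<^sup>2) \<partial>unit_prob) \<le> ennreal (((1/2) ^ k)\<^sup>2)"
    if n: "M k \<le> n" for n k
  proof -
    let ?v = "\<lambda>j u. ennreal ((norm (L2_fun (X n) u - g j u))\<^sup>2)"
    \<comment> \<open>Rewriting the integrand as a lower limit prepares for Fatou's lemma.\<close>
    have "AE u in unit_prob. ennreal ((norm (L2_fun (X n) u - f u))\<^sup>2) = liminf (\<lambda>j. ?v j u)"
      using lim_g
      by eventually_elim (intro lim_imp_Liminf[symmetric] tendsto_intros sequentially_bot)
    then have "(\<integral>\<^sup>+u. ennreal ((norm (L2_fun (X n) u - f u))\<^sup>2) \<partial>unit_prob) =
        (\<integral>\<^sup>+u. liminf (\<lambda>j. ?v j u) \<partial>unit_prob)"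
      by (rule nn_integral_cong_AE)
    also have "\<dots> \<le> liminf (\<lambda>j. integral\<^sup>N unit_prob (?v j))"
      by (rule nn_integral_liminf) simp
    also have "\<dots> \<le> ennreal (((1/2) ^ k)\<^sup>2)"
    proof (rule Liminf_le[OF sequentially_bot], rule eventually_sequentiallyI)
      fix j assume "k \<le> j"
      have "integral\<^sup>N unit_prob (?v j) = ennreal ((norm (X n - X (r j)))\<^sup>2)"
        unfolding norm_diff_L2_eq g_def
        using square_integrable_diff[OF square_integrable_L2_fun square_integrable_L2_fun]
        by (intro nn_integral_eq_integral) (auto simp: square_integrable_def)
      also have "\<dots> \<le> ennreal (((1/2) ^ k)\<^sup>2)"
        using M[of k n "r j"] n r[OF \<open>k \<le> j\<close>] by (intro ennreal_leI power_mono) auto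
      finally show "integral\<^sup>N unit_prob (?v j) \<le> ennreal (((1/2) ^ k)\<^sup>2)" .
    qed
    finally show ?thesis .
  qed
  have diff: "square_integrable (\<lambda>u. L2_fun (X n) u - f u)" if n: "M k \<le> n" for n k
  proof -
    have "(\<integral>\<^sup>+u. ennreal ((norm (L2_fun (X n) u - f u))\<^sup>2) \<partial>unit_prob) < \<infinity>"
      using F[OF n] by (rule le_less_trans) simp
    then have "integrable unit_prob (\<lambda>u. (norm (L2_fun (X n) u - f u))\<^sup>2)"
      by (intro integrableI_nonneg) auto
    then show ?thesis by (simp add: square_integrable_def)
  qed
  \<comment> \<open>\<open>f\<close> is the square-integrable \<open>L2_fun (X (M 0))\<close> minus
    the difference just treated.\<close>
  have f: "square_integrable f"
    using square_integrable_diff[OF square_integrable_L2_fun diff[OF order_refl[of "M 0"]], of "X (M 0)"] by simp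
  have "norm (X n - L2_class f) \<le> (1/2) ^ k" if n: "M k \<le> n" for n k
  proof -
    have "ennreal ((norm (X n - L2_class f))\<^sup>2) = ennreal (LINT u|unit_prob. (norm (L2_fun (X n) u - f u))\<^sup>2)"
      unfolding norm_diff_L2_eq
      by (intro arg_cong[where f=ennreal] integral_cong_AE)
         (use L2_fun_class[OF f] in \<open>auto\<close>)
    also have "\<dots> = (\<integral>\<^sup>+u. ennreal ((norm (L2_fun (X n) u - f u))\<^sup>2) \<partial>unit_prob)"
      using diff[OF n] by (intro nn_integral_eq_integral[symmetric]) (auto simp: square_integrable_def)
    also have "\<dots> \<le> ennreal (((1/2) ^ k)\<^sup>2)" by (rule F[OF n])
    finally have "(norm (X n - L2_class f))\<^sup>2 \<le> ((1/2) ^ k)\<^sup>2"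
      by (simp add: ennreal_le_iff)
    then show ?thesis by (rule power2_le_imp_le) simp
  qed
  then have dist_le: "dist (X n) (L2_class f) \<le> (1/2) ^ k" if "M k \<le> n" for n k
    using that by (simp add: dist_norm)
  have "X \<longlonglongrightarrow> L2_class f"
  proof (rule metric_LIMSEQ_I)
    fix e :: real assume "0 < e"
    then obtain k where "(1/2 :: real) ^ k < e" using real_arch_pow_inv[of e "1/2"] by auto
    then show "\<exists>no. \<forall>n\<ge>no. dist (X n) (L2_class f) < e"
      using dist_le le_less_trans by blast
  qed
  then show "convergent X" by (rule convergentI)
qed

section \<open>Convex lower semicontinuous functions on a Hilbert space\<close>

text \<open>Lower semicontinuity bounds \<open>f\<close> below near \<open>x0\<close>; convexity
  along the segment from \<open>x0\<close> to a distant point spreads this to a bound linear in the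
  distance.\<close>

lemma convex_lsc_linear_lower_bound:
  fixes f :: "'a::real_normed_vector \<Rightarrow> ereal"
  assumes convex: "\<And>x y t. 0 \<le> t \<Longrightarrow> t \<le> 1 \<Longrightarrow>
      f ((1 - t) *\<^sub>R x + t *\<^sub>R y) \<le> ereal (1 - t) * f x + ereal t * f y"
    and lsc: "\<And>x r. ereal r < f x \<Longrightarrow> \<exists>\<delta>>0. \<forall>y. dist x y < \<delta> \<longrightarrow> ereal r < f y"
    and not_MInf: "\<And>x. f x \<noteq> -\<infinity>" and x0: "f x0 \<noteq> \<infinity>"
  obtains C where "0 \<le> C" "\<And>x. ereal (- C * (1 + norm (x - z))) \<le> f x"
proof -
  obtain f0 where f0: "f x0 = ereal f0" using x0 not_MInf[of x0] by (cases "f x0") auto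
  have "ereal (f0 - 1) < f x0" by (simp add: f0)
  then obtain \<delta> where "0 < \<delta>" and \<delta>: "\<And>y. dist x0 y < \<delta> \<Longrightarrow> ereal (f0 - 1) < f y"
    using lsc by blast
  have lower: "f0 - 1 - 2 * norm (x - x0) / \<delta> \<le> fx" if fx: "f x = ereal fx" for x fx
  proof (cases "dist x0 x < \<delta>")
    case True
    then have "f0 - 1 < fx" using \<delta>[of x] fx by simp
    moreover have "0 \<le> 2 * norm (x - x0) / \<delta>" using \<open>0 < \<delta>\<close> by simp
    ultimately show ?thesis by linarith
  next
    case False
    define s where "s = norm (x - x0)"
    \<comment> \<open>This \<open>t\<close> places the intermediate point at distance
      \<open>\<delta> / 2\<close> from \<open>x0\<close>, inside the ball where the lower bound
      holds.\<close>
    define t where "t = \<delta> / (2 * s)"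
    have "\<delta> \<le> s" using False by (simp add: s_def dist_norm norm_minus_commute)
    then have t: "0 < t" "t < 1" "t * s = \<delta> / 2" using \<open>0 < \<delta>\<close> by (auto simp: t_def field_simps)
    have "x0 - ((1 - t) *\<^sub>R x0 + t *\<^sub>R x) = t *\<^sub>R (x0 - x)" by (simp add: algebra_simps)
    then have "dist x0 ((1 - t) *\<^sub>R x0 + t *\<^sub>R x) = t * s"
      using t(1) by (simp add: dist_norm s_def norm_minus_commute)
    then have "ereal (f0 - 1) < f ((1 - t) *\<^sub>R x0 + t *\<^sub>R x)"
      using \<open>0 < \<delta>\<close> t(3) by (intro \<delta>) simp
    also have "\<dots> \<le> ereal (1 - t) * f x0 + ereal t * f x" using t by (intro convex) auto
    finally have "- 1 < t * (fx - f0)" by (simp add: f0 fx algebra_simps)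
    then have "- (2 * s / \<delta>) < fx - f0"
      using \<open>0 < \<delta>\<close> \<open>\<delta> \<le> s\<close> by (simp add: t_def field_simps)
    then show ?thesis by (simp add: s_def)
  qed
  \<comment> \<open>The constant absorbs the value at \<open>x0\<close>, the slope
    \<open>2 / \<delta>\<close> and the change of centre from \<open>x0\<close> to
    \<open>z\<close>.\<close>
  define C where "C = \<bar>f0\<bar> + 1 + 2 * norm (z - x0) / \<delta> + 2 / \<delta>"
  have "ereal (- C * (1 + norm (x - z))) \<le> f x" for x
  proof (cases "f x")
    case (real fx)
    have "norm (x - x0) \<le> norm (x - z) + norm (z - x0)"
      using norm_triangle_ineq[of "x - z" "z - x0"] by simp
    then have *: "2 * norm (x - x0) / \<delta> \<le> 2 / \<delta> * norm (x - z) + 2 * norm (z - x0) / \<delta>"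
      using \<open>0 < \<delta>\<close> by (simp add: field_simps)
    have "2 / \<delta> \<le> C" using \<open>0 < \<delta>\<close> by (simp add: C_def)
    then have "2 / \<delta> * norm (x - z) \<le> C * norm (x - z)" by (rule mult_right_mono) simp
    moreover have "\<bar>f0\<bar> + 1 + 2 * norm (z - x0) / \<delta> \<le> C" using \<open>0 < \<delta>\<close> by (simp add: C_def)
    ultimately have "- C * (1 + norm (x - z)) \<le> f0 - 1 - 2 * norm (x - x0) / \<delta>"
      using * by (simp add: algebra_simps)
    also have "\<dots> \<le> fx" using real by (rule lower)
    finally show ?thesis by (simp add: real)
  qed (use not_MInf in auto)
  moreover have "0 \<le> C" using \<open>0 < \<delta>\<close> by (simp add: C_def)
  ultimately show ?thesis using that by blast
qed

text \<open>The minimizer \<open>x\<close> of \<open>f + k \<bar>\<cdot> - z\<bar>\<^sup>2\<close> has the subgradient \<open>2 k (z - x)\<close>, and for large \<open>k\<close>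
  the supporting affine function exceeds \<open>r\<close> at \<open>z\<close>.\<close>

lemma convex_lsc_affine_minorant:
  fixes f :: "'a::{real_inner, complete_space} \<Rightarrow> ereal"
  assumes convex: "\<And>x y t. 0 \<le> t \<Longrightarrow> t \<le> 1 \<Longrightarrow>
      f ((1 - t) *\<^sub>R x + t *\<^sub>R y) \<le> ereal (1 - t) * f x + ereal t * f y"
    and lsc: "\<And>x r. ereal r < f x \<Longrightarrow> \<exists>\<delta>>0. \<forall>y. dist x y < \<delta> \<longrightarrow> ereal r < f y"
    and not_MInf: "\<And>x. f x \<noteq> -\<infinity>" and x0: "f x0 \<noteq> \<infinity>" and r: "ereal r < f z"
  obtains y a where "\<And>x. ereal (x \<bullet> y - a) \<le> f x" "r \<le> z \<bullet> y - a"
proof -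
  obtain C where "0 \<le> C" and C: "\<And>x. ereal (- C * (1 + norm (x - z))) \<le> f x"
    using convex_lsc_linear_lower_bound[OF convex lsc not_MInf x0] by blast
  obtain \<delta> where "0 < \<delta>" and \<delta>: "\<And>y. dist z y < \<delta> \<Longrightarrow> ereal r < f y"
    using lsc[OF r] by blast
  \<comment> \<open>With these constants the penalty in \<open>F\<close> outweighs the linear lower
    bound of \<open>f\<close> outside the \<open>\<delta>\<close>-ball around \<open>z\<close>,
    where \<open>norm (x - z) = \<delta> * s\<close> with \<open>1 \<le> s\<close>. The summand 1
    keeps \<open>k\<close> positive.\<close>
  define B where "B = \<bar>r\<bar> + C + C * \<delta>"
  define k where "k = B / \<delta>\<^sup>2 + 1"
  have "0 \<le> B" using \<open>0 \<le> C\<close> \<open>0 < \<delta>\<close> by (simp add: B_def)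
  then have "0 < k" using \<open>0 < \<delta>\<close> by (simp add: k_def add_nonneg_pos)
  define F where "F x = f x + ereal (k * (norm (x - z))\<^sup>2)" for x
  have F_ge: "ereal r \<le> F x" for x
  proof (cases "dist z x < \<delta>")
    case True
    have "ereal r + 0 \<le> f x + ereal (k * (norm (x - z))\<^sup>2)"
      using \<delta>[OF True] \<open>0 < k\<close> by (intro add_mono) auto
    then show ?thesis by (simp add: F_def)
  next
    case False
    define s where "s = norm (x - z) / \<delta>"
    have s: "1 \<le> s" "norm (x - z) = \<delta> * s"
      using False \<open>0 < \<delta>\<close> by (auto simp: s_def dist_norm norm_minus_commute)
    have "s \<le> s\<^sup>2" using s(1) by (simp add: power2_eq_square)
    then have "\<bar>r\<bar> + C + C * \<delta> * s \<le> B * s\<^sup>2"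
      using s(1) \<open>0 \<le> C\<close> \<open>0 < \<delta>\<close> mult_left_mono[of s "s\<^sup>2" "C * \<delta>"] mult_left_mono[of 1 "s\<^sup>2" "\<bar>r\<bar> + C"]
      by (simp add: B_def algebra_simps)
    also have "B * s\<^sup>2 \<le> k * (norm (x - z))\<^sup>2"
      using \<open>0 < \<delta>\<close> by (simp add: k_def s(2) power_mult_distrib field_simps)
    finally have "r \<le> - C * (1 + norm (x - z)) + k * (norm (x - z))\<^sup>2"
      by (simp add: s(2) algebra_simps)
    then have "ereal r \<le> ereal (- C * (1 + norm (x - z))) + ereal (k * (norm (x - z))\<^sup>2)" by simp
    also have "\<dots> \<le> F x" unfolding F_def by (intro add_mono C) simp
    finally show ?thesis .
  qed
  have "ereal r \<le> (INF x. F x)" by (intro INF_greatest F_ge)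
  moreover have "(INF x. F x) \<le> F x0" by (rule INF_lower) simp
  moreover have "F x0 \<noteq> \<infinity>" using x0 by (simp add: F_def)
  ultimately obtain m where m: "(INF x. F x) = ereal m"
    by (cases "INF x. F x") auto
  have m_le: "ereal m \<le> F x" for x unfolding m[symmetric] by (rule INF_lower) simp
  have "r \<le> m" using \<open>ereal r \<le> (INF x. F x)\<close> m by simp
  have "\<exists>x. F x < ereal (m + 1 / real (Suc n))" for n
    using INF_less_iff[of F UNIV "ereal (m + 1 / real (Suc n))"] by (simp add: m)
  then obtain X where X: "\<And>n. F (X n) < ereal (m + 1 / real (Suc n))" by metis
  define v where "v n = real_of_ereal (f (X n))" for n
  have v: "f (X n) = ereal (v n)" for n
    using X[of n] not_MInf[of "X n"] unfolding v_def F_def by (cases "f (X n)") auto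
  have X_bound: "v n + k * (norm (X n - z))\<^sup>2 < m + 1 / real (Suc n)" for n
    using X[of n] by (simp add: F_def v)
  \<comment> \<open>\<open>F\<close> is at least \<open>m\<close> at the midpoint of two nearly
    minimizing points; the parallelogram identity turns this into closeness of the two.\<close>
  have close: "(norm (X i - X j))\<^sup>2 \<le> 2 / k * (1 / real (Suc i) + 1 / real (Suc j))" for i j
  proof -
    define p where "p = (1 - 1/2) *\<^sub>R X i + (1/2) *\<^sub>R X j"
    have "f p \<le> ereal (1 - 1/2) * f (X i) + ereal (1/2) * f (X j)"
      unfolding p_def by (intro convex) auto
    then have "f p \<le> ereal (v i / 2 + v j / 2)" by (simp add: v)
    then have "F p \<le> ereal (v i / 2 + v j / 2 + k * (norm (p - z))\<^sup>2)"
      by (cases "f p") (auto simp: F_def)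
    with m_le[of p] have "m \<le> v i / 2 + v j / 2 + k * (norm (p - z))\<^sup>2"
      using order_trans ereal_less_eq(3) by blast
    moreover have "p - z = (1/2) *\<^sub>R ((X i - z) + (X j - z))"
      by (simp add: p_def algebra_simps flip: scaleR_add_left)
    then have "(norm (p - z))\<^sup>2 = (norm (X i - z))\<^sup>2 / 2 + (norm (X j - z))\<^sup>2 / 2 - (norm ((X i - z) - (X j - z)))\<^sup>2 / 4"
      unfolding power2_norm_eq_inner by (simp add: inner_add inner_diff inner_commute field_simps)
    then have "k * (norm (p - z))\<^sup>2 = k * (norm (X i - z))\<^sup>2 / 2 + k * (norm (X j - z))\<^sup>2 / 2 - k * (norm (X i - X j))\<^sup>2 / 4"
      by (simp add: right_diff_distrib distrib_left)
    ultimately have "k * (norm (X i - X j))\<^sup>2 / 4 \<le> (1 / real (Suc i) + 1 / real (Suc j)) / 2"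
      using X_bound[of i] X_bound[of j] by argo
    moreover have "d \<le> 2 / k * e" if "k * d / 4 \<le> e / 2" for d e
      using that \<open>0 < k\<close> by (simp add: field_simps)
    ultimately show ?thesis by blast
  qed
  have "Cauchy X"
  proof (rule metric_CauchyI)
    fix e :: real assume "0 < e"
    then have "0 < k * e\<^sup>2 / 4" using \<open>0 < k\<close> by simp
    then obtain N where N: "1 / real (Suc N) < k * e\<^sup>2 / 4"
      using reals_Archimedean[of "k * e\<^sup>2 / 4"] by (auto simp: inverse_eq_divide)
    have "dist (X i) (X j) < e" if "N \<le> i" "N \<le> j" for i j
    proof -
      have "1 / real (Suc i) \<le> 1 / real (Suc N)" "1 / real (Suc j) \<le> 1 / real (Suc N)"
        using that by (auto simp: frac_le)
      then have "1 / real (Suc i) + 1 / real (Suc j) < k * e\<^sup>2 / 2" using N by linarith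
      then have "2 / k * (1 / real (Suc i) + 1 / real (Suc j)) < 2 / k * (k * e\<^sup>2 / 2)"
        using \<open>0 < k\<close> by (intro mult_strict_left_mono) auto
      then have "(norm (X i - X j))\<^sup>2 < e\<^sup>2" using close[of i j] \<open>0 < k\<close> by simp
      then show ?thesis using \<open>0 < e\<close> by (simp add: dist_norm power2_less_imp_less)
    qed
    then show "\<exists>M. \<forall>i\<ge>M. \<forall>j\<ge>M. dist (X i) (X j) < e" by blast
  qed
  then obtain x where x: "X \<longlonglongrightarrow> x" using Cauchy_convergent_iff convergent_def by blast
  \<comment> \<open>Lower semicontinuity passes to the limit of the minimizing sequence, so the
    infimum is attained at \<open>x\<close>.\<close>
  have "F x \<le> ereal m"
  proof (rule ccontr)
    assume "\<not> F x \<le> ereal m"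
    then have "ereal (m - k * (norm (x - z))\<^sup>2) < f x"
      using not_MInf[of x] unfolding F_def by (cases "f x") auto
    then obtain s where s: "ereal (m - k * (norm (x - z))\<^sup>2) < ereal s" "ereal s < f x"
      using ereal_dense2 by blast
    obtain \<delta> where "0 < \<delta>" and \<delta>: "\<And>y. dist x y < \<delta> \<Longrightarrow> ereal s < f y"
      using lsc[OF s(2)] by blast
    have "eventually (\<lambda>n. dist (X n) x < \<delta>) sequentially"
      using x \<open>0 < \<delta>\<close> by (rule tendstoD)
    then have ev: "eventually (\<lambda>n. s + k * (norm (X n - z))\<^sup>2 \<le> m + 1 / real (Suc n)) sequentially"
    proof eventually_elim
      case (elim n)
      then have "s < v n" using \<delta>[of "X n"] v[of n] by (simp add: dist_commute)
      then show ?case using X_bound[of n] by linarith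
    qed
    have "s + k * (norm (x - z))\<^sup>2 \<le> m + 0"
      by (rule tendsto_le[OF sequentially_bot _ _ ev])
         (intro tendsto_intros x LIMSEQ_Suc lim_1_over_n)+
    then show False using s(1) by simp
  qed
  then have Fx: "F x = ereal m" using m_le[of x] by (rule antisym)
  then obtain fx where fx: "f x = ereal fx" using not_MInf[of x] unfolding F_def by (cases "f x") auto
  have m_eq: "m = fx + k * (norm (x - z))\<^sup>2" using Fx by (simp add: F_def fx)
  define y where "y = (2 * k) *\<^sub>R (z - x)"
  have sub: "ereal (fx + (w - x) \<bullet> y) \<le> f w" for w
  proof (cases "f w")
    case (real fw)
    define D where "D = fw - fx - (w - x) \<bullet> y"
    define N where "N = k * (norm (w - x))\<^sup>2"
    have "0 \<le> N" using \<open>0 < k\<close> by (simp add: N_def)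
    have norm_expand: "(norm (a + t *\<^sub>R b))\<^sup>2 = (norm a)\<^sup>2 + 2 * t * (b \<bullet> a) + t * (t * (norm b)\<^sup>2)"
      for a b :: 'a and t
      unfolding power2_norm_eq_inner by (simp add: inner_add_left inner_add_right inner_commute)
    \<comment> \<open>Comparing the minimum at \<open>x\<close> with the value at \<open>p\<close>
      on the segment to \<open>w\<close> and dividing by \<open>t\<close> leaves this condition,
      which forces \<open>0 \<le> D\<close> as \<open>t\<close> tends to 0.\<close>
    have key: "0 \<le> D + t * N" if t: "0 < t" "t \<le> 1" for t
    proof -
      define p where "p = (1 - t) *\<^sub>R x + t *\<^sub>R w"
      have "f p \<le> ereal (1 - t) * f x + ereal t * f w"
        unfolding p_def using t by (intro convex) auto
      then have "f p \<le> ereal ((1 - t) * fx + t * fw)" by (simp add: fx real)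
      then have "F p \<le> ereal ((1 - t) * fx + t * fw + k * (norm (p - z))\<^sup>2)"
        by (cases "f p") (auto simp: F_def)
      with m_le[of p] have "m \<le> (1 - t) * fx + t * fw + k * (norm (p - z))\<^sup>2"
        using order_trans ereal_less_eq(3) by blast
      moreover have "p - z = (x - z) + t *\<^sub>R (w - x)" by (simp add: p_def algebra_simps)
      then have norm_p: "(norm (p - z))\<^sup>2 = (norm (x - z))\<^sup>2 + 2 * t * ((w - x) \<bullet> (x - z)) + t * (t * (norm (w - x))\<^sup>2)"
        by (simp only: norm_expand)
      have "(w - x) \<bullet> y = - (2 * k) * ((w - x) \<bullet> (x - z))"
        by (simp add: y_def inner_diff_right algebra_simps)
      then have "k * (norm (p - z))\<^sup>2 = k * (norm (x - z))\<^sup>2 - t * ((w - x) \<bullet> y) + t * (t * N)"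
        unfolding norm_p N_def by (simp only: distrib_left) simp
      ultimately have "0 \<le> t * (D + t * N)" unfolding m_eq D_def by (simp add: algebra_simps)
      then show ?thesis using t(1) by (simp add: zero_le_mult_iff)
    qed
    have "0 \<le> D"
    proof (rule ccontr)
      assume "\<not> 0 \<le> D"
      \<comment> \<open>For \<open>D < 0\<close> and \<open>t \<le> q\<close> the term
        \<open>t * N\<close> stays below \<open>- D\<close>, against \<open>key\<close>; the 1 keeps
        the denominator positive.\<close>
      define q where "q = - D / (2 * (N + 1))"
      define t where "t = min 1 q"
      have "0 < q" using \<open>\<not> 0 \<le> D\<close> \<open>0 \<le> N\<close> by (simp add: q_def divide_less_0_iff)
      then have "0 < t" "t \<le> 1" "t \<le> q" by (simp_all add: t_def)
      moreover have "t * N \<le> q * N"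
        using \<open>t \<le> q\<close> \<open>0 \<le> N\<close> by (rule mult_right_mono)
      moreover have "q * N + q * N + 2 * q = - D"
      proof -
        have "q * (2 * (N + 1)) = - D" using \<open>0 \<le> N\<close> by (simp add: q_def)
        then show ?thesis by (simp add: algebra_simps)
      qed
      moreover have "0 \<le> q * N" using \<open>0 < q\<close> \<open>0 \<le> N\<close> by simp
      ultimately show False using key[of t] \<open>0 < q\<close> by linarith
    qed
    then show ?thesis by (simp add: real D_def)
  qed (use not_MInf in auto)
  show ?thesis
  proof (rule that)
    show "ereal (w \<bullet> y - (x \<bullet> y - fx)) \<le> f w" for w
      using sub[of w] by (simp add: inner_diff_left algebra_simps)
    \<comment> \<open>At \<open>z\<close> the supporting affine function is \<open>fx\<close> plus
      twice the penalty, hence at least the minimum \<open>m\<close>.\<close>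
    have "(z - x) \<bullet> y = 2 * (k * (norm (x - z))\<^sup>2)"
      by (simp add: y_def power2_norm_eq_inner[symmetric] norm_minus_commute)
    moreover have "0 \<le> k * (norm (x - z))\<^sup>2" using \<open>0 < k\<close> by simp
    ultimately have "m \<le> fx + (z - x) \<bullet> y" unfolding m_eq by linarith
    then show "r \<le> z \<bullet> y - (x \<bullet> y - fx)" using \<open>r \<le> m\<close> by (simp add: inner_diff_left)
  qed
qed

section \<open>Correlation and Wasserstein distance through random variables\<close>

lemma measurable_fst_borel [measurable]: "fst \<in> borel_measurable (borel :: ('a::topological_space \<times> 'b::topological_space) measure)"
  by (intro borel_measurable_continuous_onI continuous_on_fst continuous_on_id)

lemma measurable_snd_borel [measurable]: "snd \<in> borel_measurable (borel :: ('a::topological_space \<times> 'b::topological_space) measure)"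
  by (intro borel_measurable_continuous_onI continuous_on_snd continuous_on_id)

lemma power2_norm_prod: "(norm p)\<^sup>2 = (norm (fst p))\<^sup>2 + (norm (snd p))\<^sup>2"
  by (simp add: norm_prod_def)

section \<open>Measures in \<open>P2\<close> as laws, couplings as joint laws\<close>

definition law :: "'a::{real_inner, polish_space} L2 \<Rightarrow> 'a measure" where
  "law X = distr unit_prob borel (L2_fun X)"

definition joint :: "'a::{real_inner, polish_space} L2 \<Rightarrow> 'a L2 \<Rightarrow> ('a \<times> 'a) measure" where
  "joint X Y = distr unit_prob borel (\<lambda>u. (L2_fun X u, L2_fun Y u))"

lemma integrable_norm2_L2: "integrable unit_prob (\<lambda>u. (norm (L2_fun X u))\<^sup>2)"
  using square_integrable_L2_fun[of X] by (simp add: square_integrable_def)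

lemma law_L2_class: "square_integrable f \<Longrightarrow> law (L2_class f) = distr unit_prob borel f"
  unfolding law_def using L2_fun_class[of f] by (intro distr_cong_AE) auto

lemma law_P2 [simp]: "law X \<in> P2"
  unfolding P2_def law_def
  using integrable_norm2_L2[of X] by (auto intro!: unit_prob.prob_space_distr simp: integrable_distr_eq)

lemma m2_law: "m2 (law X) = norm X"
proof -
  have "(LINT x|law X. (norm x)\<^sup>2) = (norm X)\<^sup>2"
    unfolding law_def norm_L2_eq by (rule integral_distr) auto
  then show ?thesis by (simp add: m2_def)
qed

lemma joint_P2 [simp]: "joint X Y \<in> P2"
proof -
  have "integrable (joint X Y) (\<lambda>p. (norm p)\<^sup>2)"
    unfolding joint_def using integrable_norm2_L2[of X] integrable_norm2_L2[of Y]
    by (simp add: integrable_distr_eq power2_norm_prod)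
  then show ?thesis
    unfolding P2_def by (auto simp: joint_def intro!: unit_prob.prob_space_distr)
qed

lemma joint_fst: "distr (joint X Y) borel fst = law X"
  unfolding joint_def law_def by (subst distr_distr) (auto simp: comp_def)

lemma joint_snd: "distr (joint X Y) borel snd = law Y"
  unfolding joint_def law_def by (subst distr_distr) (auto simp: comp_def)

lemma joint_interpolation:
  "distr (joint X Y) borel (\<lambda>(x, y). (1 - t) *\<^sub>R x + t *\<^sub>R y) = law ((1 - t) *\<^sub>R X + t *\<^sub>R Y)"
proof -
  have [measurable]: "(\<lambda>(x, y). (1 - t) *\<^sub>R x + t *\<^sub>R y :: 'a) \<in> borel_measurable borel"
    unfolding case_prod_beta by measurable
  have "distr (joint X Y) borel (\<lambda>(x, y). (1 - t) *\<^sub>R x + t *\<^sub>R y) =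
      distr unit_prob borel (\<lambda>u. (1 - t) *\<^sub>R L2_fun X u + t *\<^sub>R L2_fun Y u)"
    unfolding joint_def by (subst distr_distr) (auto simp: comp_def)
  also have "\<dots> = law ((1 - t) *\<^sub>R X + t *\<^sub>R Y)"
    unfolding law_def
  proof (rule distr_cong_AE)
    show "AE u in unit_prob. (1 - t) *\<^sub>R L2_fun X u + t *\<^sub>R L2_fun Y u =
        L2_fun ((1 - t) *\<^sub>R X + t *\<^sub>R Y) u"
      using L2_fun_add[of "(1 - t) *\<^sub>R X" "t *\<^sub>R Y"] L2_fun_scaleR[of "1 - t" X] L2_fun_scaleR[of t Y]
      by eventually_elim simp
  qed auto
  finally show ?thesis .
qed

lemma joint_inner: "(LINT p|joint X Y. fst p \<bullet> snd p) = X \<bullet> Y"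
  unfolding joint_def inner_L2_eq by (subst integral_distr) auto

lemma joint_norm_diff: "(LINT p|joint X Y. (norm (fst p - snd p))\<^sup>2) = (norm (X - Y))\<^sup>2"
  unfolding joint_def norm_diff_L2_eq by (subst integral_distr) auto

text \<open>The pair space is again Polish, so \<open>M\<close> is the law of a single variable; its
  components are square integrable since their norms are dominated by that of the pair.\<close>

lemma P2_pair_representation:
  fixes M :: "('a::{real_inner, polish_space} \<times> 'a) measure"
  assumes "M \<in> P2"
  obtains X Y where "joint X Y = M"
proof -
  from assms have M: "prob_space M" "sets M = sets borel" and int: "integrable M (\<lambda>p. (norm p)\<^sup>2)"
    by (auto simp: P2_def)
  have "real_distribution unit_prob"
    unfolding real_distribution_def real_distribution_axioms_def by (simp add: unit_prob.prob_space_axioms)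
  then obtain Z where [measurable]: "Z \<in> borel_measurable borel" and Z: "distr unit_prob borel Z = M"
    by (rule atomless_representation[OF _ _ M]) (auto simp: measure_def unit_prob_singleton)
  have "integrable (distr unit_prob borel Z) (\<lambda>p. (norm p)\<^sup>2)"
    using int Z by simp
  then have int_Z: "integrable unit_prob (\<lambda>u. (norm (Z u))\<^sup>2)"
    by (subst (asm) integrable_distr_eq) auto
  have "integrable unit_prob (\<lambda>u. (norm (fst (Z u)))\<^sup>2)" "integrable unit_prob (\<lambda>u. (norm (snd (Z u)))\<^sup>2)"
    by (rule Bochner_Integration.integrable_bound[OF int_Z]; simp add: power2_norm_prod)+
  then have sq: "square_integrable (\<lambda>u. fst (Z u))" "square_integrable (\<lambda>u. snd (Z u))"
    by (simp_all add: square_integrable_def)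
  have "joint (L2_class (\<lambda>u. fst (Z u))) (L2_class (\<lambda>u. snd (Z u))) = distr unit_prob borel Z"
    unfolding joint_def
  proof (rule distr_cong_AE)
    show "AE u in unit_prob. (L2_fun (L2_class (\<lambda>u. fst (Z u))) u, L2_fun (L2_class (\<lambda>u. snd (Z u))) u) = Z u"
      using L2_fun_class[OF sq(1)] L2_fun_class[OF sq(2)] by eventually_elim simp
  qed auto
  then show ?thesis using Z that by simp
qed

text \<open>The second moment of a coupling is the sum of those of its marginals, so the coupling
  lies in \<open>P2\<close> and the pair representation applies.\<close>

lemma coupling_representation:
  assumes "\<mu> \<in> P2" "\<nu> \<in> P2" "\<gamma> \<in> couplings \<mu> \<nu>"
  obtains X Y where "joint X Y = \<gamma>" "law X = \<mu>" "law Y = \<nu>"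
proof -
  from assms(3) have \<gamma>: "prob_space \<gamma>" "sets \<gamma> = sets borel"
    and marg: "distr \<gamma> borel fst = \<mu>" "distr \<gamma> borel snd = \<nu>"
    by (auto simp: couplings_def)
  note [measurable_cong] = \<gamma>(2)
  have "integrable (distr \<gamma> borel fst) (\<lambda>x. (norm x)\<^sup>2)" "integrable (distr \<gamma> borel snd) (\<lambda>x. (norm x)\<^sup>2)"
    using assms(1,2) unfolding marg by (auto simp: P2_def)
  then have "integrable \<gamma> (\<lambda>p. (norm p)\<^sup>2)"
    by (simp add: integrable_distr_eq power2_norm_prod)
  with \<gamma> have "\<gamma> \<in> P2" by (simp add: P2_def)
  then obtain X Y where "joint X Y = \<gamma>" by (rule P2_pair_representation)
  with marg that show ?thesis by (auto simp: joint_fst joint_snd)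
qed

lemma joint_coupling: "joint X Y \<in> couplings (law X) (law Y)"
  using joint_P2[of X Y] by (simp add: couplings_def joint_fst joint_snd P2_def)

lemma P2_representation:
  assumes "\<mu> \<in> P2" obtains X where "law X = \<mu>"
proof -
  from assms have \<mu>: "prob_space \<mu>" "sets \<mu> = sets borel" and int: "integrable \<mu> (\<lambda>x. (norm x)\<^sup>2)"
    by (auto simp: P2_def)
  note [measurable_cong] = \<mu>(2)
  \<comment> \<open>The diagonal coupling reduces a single measure to a pair.\<close>
  have "distr \<mu> borel (\<lambda>x. (x, x)) \<in> couplings \<mu> \<mu>"
    using \<mu> distr_id2[of borel \<mu>]
    by (auto simp: couplings_def distr_distr comp_def intro!: prob_space.prob_space_distr)
  then show ?thesis by (rule coupling_representation[OF assms assms]) (rule that)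
qed

lemma couplings_nonempty: "\<mu> \<in> P2 \<Longrightarrow> \<nu> \<in> P2 \<Longrightarrow> couplings \<mu> \<nu> \<noteq> {}"
  by (metis P2_representation joint_coupling empty_iff)

section \<open>Correlation and distance as extrema over variables\<close>

lemma inner_le_corr: "X \<bullet> Y \<le> corr (law X) (law Y)"
proof -
  \<comment> \<open>The real supremum needs a bounded set; Cauchy-Schwarz bounds it, as norms depend
    on the law alone.\<close>
  have "(LINT p|\<gamma>. fst p \<bullet> snd p) \<le> norm X * norm Y" if \<gamma>: "\<gamma> \<in> couplings (law X) (law Y)" for \<gamma>
  proof -
    obtain X' Y' where XY: "joint X' Y' = \<gamma>" "law X' = law X" "law Y' = law Y"
      using coupling_representation[OF law_P2 law_P2 \<gamma>] by blast
    then have "norm X' = norm X" "norm Y' = norm Y" by (metis m2_law)+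
    then show ?thesis
      using norm_cauchy_schwarz[of X' Y'] by (simp add: XY(1)[symmetric] joint_inner)
  qed
  then have "bdd_above ((\<lambda>\<gamma>. LINT p|\<gamma>. fst p \<bullet> snd p) ` couplings (law X) (law Y))"
    by (auto intro!: bdd_aboveI)
  then have "(LINT p|joint X Y. fst p \<bullet> snd p) \<le> corr (law X) (law Y)"
    unfolding corr_def by (intro cSUP_upper joint_coupling)
  then show ?thesis by (simp add: joint_inner)
qed

text \<open>Near-optimal variables take the place of an optimal coupling in later estimates.\<close>

lemma less_corrE:
  assumes "\<mu> \<in> P2" "\<nu> \<in> P2" "c < corr \<mu> \<nu>"
  obtains X Y where "law X = \<mu>" "law Y = \<nu>" "c < X \<bullet> Y"
proof -
  obtain \<gamma> where \<gamma>: "\<gamma> \<in> couplings \<mu> \<nu>" "c < (LINT p|\<gamma>. fst p \<bullet> snd p)"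
    using less_cSupD[of "(\<lambda>\<gamma>. LINT p|\<gamma>. fst p \<bullet> snd p) ` couplings \<mu> \<nu>" c]
      couplings_nonempty[OF assms(1,2)] assms(3) by (auto simp: corr_def)
  obtain X Y where "joint X Y = \<gamma>" "law X = \<mu>" "law Y = \<nu>"
    using coupling_representation[OF assms(1,2) \<gamma>(1)] by blast
  with \<gamma>(2) that show ?thesis by (auto simp: joint_inner)
qed

lemma w2_nonneg: "\<mu> \<in> P2 \<Longrightarrow> \<nu> \<in> P2 \<Longrightarrow> 0 \<le> w2 \<mu> \<nu>"
  unfolding w2_def by (intro real_sqrt_ge_zero cINF_greatest couplings_nonempty) auto

lemma w2_law_le: "w2 (law X) (law Y) \<le> norm (X - Y)"
proof -
  have "bdd_below ((\<lambda>\<gamma>. LINT p|\<gamma>. (norm (fst p - snd p))\<^sup>2) ` couplings (law X) (law Y))"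
    by (auto intro!: bdd_belowI[of _ 0])
  then have "(INF \<gamma>\<in>couplings (law X) (law Y). LINT p|\<gamma>. (norm (fst p - snd p))\<^sup>2) \<le>
      (LINT p|joint X Y. (norm (fst p - snd p))\<^sup>2)"
    by (intro cINF_lower joint_coupling)
  then show ?thesis
    unfolding w2_def by (intro real_le_lsqrt) (auto simp: joint_norm_diff)
qed

lemma w2_lessE:
  assumes "\<mu> \<in> P2" "\<nu> \<in> P2" "w2 \<mu> \<nu> < d"
  obtains X Y where "law X = \<mu>" "law Y = \<nu>" "norm (X - Y) < d"
proof -
  have "0 \<le> w2 \<mu> \<nu>" using assms(1,2) by (rule w2_nonneg)
  with assms(3) have "0 < d" by linarith
  have "(INF \<gamma>\<in>couplings \<mu> \<nu>. LINT p|\<gamma>. (norm (fst p - snd p))\<^sup>2) < d\<^sup>2"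
    using assms(3) \<open>0 < d\<close> unfolding w2_def by (metis abs_of_pos real_sqrt_abs real_sqrt_less_iff)
  then obtain \<gamma> where \<gamma>: "\<gamma> \<in> couplings \<mu> \<nu>" "(LINT p|\<gamma>. (norm (fst p - snd p))\<^sup>2) < d\<^sup>2"
    using couplings_nonempty[OF assms(1,2)] by (metis (no_types, lifting) cINF_greatest not_less)
  obtain X Y where XY: "joint X Y = \<gamma>" "law X = \<mu>" "law Y = \<nu>"
    using coupling_representation[OF assms(1,2) \<gamma>(1)] by blast
  with \<gamma>(2) have "(norm (X - Y))\<^sup>2 < d\<^sup>2" by (auto simp: joint_norm_diff)
  then have "norm (X - Y) < d" by (rule power2_less_imp_less) (use \<open>0 < d\<close> in simp)
  with XY that show ?thesis by blast
qed

lemma corr_commute: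
  assumes "\<mu> \<in> P2" "\<nu> \<in> P2" shows "corr \<mu> \<nu> = corr \<nu> \<mu>"
proof -
  have "corr \<mu> \<nu> \<le> corr \<nu> \<mu>" if *: "\<mu> \<in> P2" "\<nu> \<in> P2" for \<mu> \<nu> :: "'a measure"
  proof (rule dense_le)
    fix c assume "c < corr \<mu> \<nu>"
    then obtain X Y where XY: "law X = \<mu>" "law Y = \<nu>" "c < X \<bullet> Y" by (rule less_corrE[OF *])
    have "Y \<bullet> X \<le> corr \<nu> \<mu>" using inner_le_corr[of Y X] XY by simp
    then show "c \<le> corr \<nu> \<mu>" using XY(3) by (simp add: inner_commute)
  qed
  then show ?thesis using assms by (intro antisym) auto
qed

text \<open>Expanding \<open>(norm (X - Y))\<^sup>2\<close>, the squared norms are fixed by the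
  laws, so small distance and large inner product are the same goal; near-optimal variables for
  either one give the two inequalities.\<close>

lemma cost_eq:
  assumes "\<mu> \<in> P2" "\<nu> \<in> P2"
  shows "cost \<mu> \<nu> = (m2 \<mu>)\<^sup>2 / 2 + (m2 \<nu>)\<^sup>2 / 2 - corr \<mu> \<nu>"
proof -
  have norm_diff: "(norm (X - Y))\<^sup>2 = (m2 \<mu>)\<^sup>2 + (m2 \<nu>)\<^sup>2 - 2 * (X \<bullet> Y)"
    if "law X = \<mu>" "law Y = \<nu>" for X Y
    unfolding that[symmetric] m2_law power2_norm_eq_inner by (simp add: inner_diff inner_commute)
  have "corr \<mu> \<nu> \<le> (m2 \<mu>)\<^sup>2 / 2 + (m2 \<nu>)\<^sup>2 / 2 - (w2 \<mu> \<nu>)\<^sup>2 / 2"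
  proof (rule dense_le)
    fix c assume "c < corr \<mu> \<nu>"
    then obtain X Y where XY: "law X = \<mu>" "law Y = \<nu>" "c < X \<bullet> Y" by (rule less_corrE[OF assms])
    have "w2 \<mu> \<nu> \<le> norm (X - Y)" using w2_law_le[of X Y] XY by simp
    then have "(w2 \<mu> \<nu>)\<^sup>2 \<le> (norm (X - Y))\<^sup>2" using w2_nonneg[OF assms] by (rule power_mono)
    then show "c \<le> (m2 \<mu>)\<^sup>2 / 2 + (m2 \<nu>)\<^sup>2 / 2 - (w2 \<mu> \<nu>)\<^sup>2 / 2"
      using norm_diff[OF XY(1,2)] XY(3) by linarith
  qed
  moreover have "(m2 \<mu>)\<^sup>2 + (m2 \<nu>)\<^sup>2 - 2 * corr \<mu> \<nu> \<le> (w2 \<mu> \<nu>)\<^sup>2"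
  proof -
    define q where "q = (m2 \<mu>)\<^sup>2 + (m2 \<nu>)\<^sup>2 - 2 * corr \<mu> \<nu>"
    have "sqrt q \<le> w2 \<mu> \<nu>"
    proof (rule dense_ge)
      fix d assume "w2 \<mu> \<nu> < d"
      then obtain X Y where XY: "law X = \<mu>" "law Y = \<nu>" "norm (X - Y) < d" by (rule w2_lessE[OF assms])
      have "q \<le> (norm (X - Y))\<^sup>2"
        using norm_diff[OF XY(1,2)] inner_le_corr[of X Y] XY(1,2) by (simp add: q_def)
      then have "sqrt q \<le> norm (X - Y)" by (intro real_le_lsqrt) auto
      then show "sqrt q \<le> d" using XY(3) by simp
    qed
    then show ?thesis unfolding q_def[symmetric] by (rule sqrt_le_D)
  qed
  ultimately show ?thesis by (simp add: cost_def)
qed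

text \<open>Partitioning \<open>'a\<close> into small cells, on each of which \<open>X\<close> is nearly constant, replaces an exact
  transfer of couplings, which would need regular conditional distributions.\<close>

lemma corr_transfer:
  assumes "\<nu> \<in> P2" "c < corr (law X) \<nu>"
  obtains Y where "law Y = \<nu>" "c < X \<bullet> Y"
proof -
  obtain X' Y' where X': "law X' = law X" and Y': "law Y' = \<nu>" and c: "c < X' \<bullet> Y'"
    using less_corrE[OF law_P2 assms] by blast
  \<comment> \<open>Rounding \<open>X\<close> and rounding \<open>X'\<close> to cell centres will
    cost at most \<open>e * norm Y'\<close> each; this \<open>e\<close> leaves a margin of exactly
    \<open>e\<close> above \<open>c\<close>.\<close>
  define e where "e = (X' \<bullet> Y' - c) / (2 * norm Y' + 1)"
  have "0 < 2 * norm Y' + 1" by (simp add: add_nonneg_pos)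
  then have "0 < e" and e: "e * (2 * norm Y' + 1) = X' \<bullet> Y' - c" using c by (auto simp: e_def)
  obtain i :: "'a \<Rightarrow> nat" and p where i [measurable]: "i \<in> measurable borel (count_space UNIV)"
    and p: "\<And>y. dist y (p (i y)) < e"
    using fine_partition[OF \<open>0 < e\<close>] by blast
  have [measurable]: "p \<in> measurable (count_space UNIV) borel" by simp
  have cell: "square_integrable (\<lambda>u. p (i (L2_fun Z u)))"
    and cell_norm: "norm (Z - L2_class (\<lambda>u. p (i (L2_fun Z u)))) \<le> e" for Z
  proof -
    let ?d = "\<lambda>u. L2_fun Z u - p (i (L2_fun Z u))"
    have [measurable]: "(\<lambda>u. p (i (L2_fun Z u))) \<in> borel_measurable borel"
      by measurable
    have bound: "norm ((norm (?d u))\<^sup>2) \<le> e\<^sup>2" for u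
      using p[of "L2_fun Z u"] by (auto simp: dist_norm intro!: power_mono)
    have int: "integrable unit_prob (\<lambda>u. (norm (?d u))\<^sup>2)"
      by (rule unit_prob.integrable_const_bound[of _ "e\<^sup>2"]) (use bound in auto)
    then have "square_integrable ?d"
      by (simp add: square_integrable_def)
    then show sq: "square_integrable (\<lambda>u. p (i (L2_fun Z u)))"
      using square_integrable_diff[OF square_integrable_L2_fun[of Z], of ?d] by simp
    have "(norm (Z - L2_class (\<lambda>u. p (i (L2_fun Z u)))))\<^sup>2 = (LINT u|unit_prob. (norm (?d u))\<^sup>2)"
      unfolding norm_diff_L2_eq using L2_fun_class[OF sq] by (intro integral_cong_AE) auto
    also have "\<dots> \<le> (LINT u|unit_prob. e\<^sup>2)"
      using bound by (intro integral_mono int) auto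
    also have "\<dots> = e\<^sup>2" using unit_prob.prob_space by simp
    finally show "norm (Z - L2_class (\<lambda>u. p (i (L2_fun Z u)))) \<le> e"
      using \<open>0 < e\<close> by (auto intro: power2_le_imp_le)
  qed
  let ?P = "count_space UNIV \<Otimes>\<^sub>M borel"
  \<comment> \<open>Equal laws give equally distributed cell indices, as
    \<open>discrete_transfer\<close> requires.\<close>
  have "distr (law X) (count_space UNIV) i = distr (law X') (count_space UNIV) i"
    by (simp add: X')
  then have cell_law: "distr unit_prob (count_space UNIV) (\<lambda>u. i (L2_fun X u)) =
      distr unit_prob (count_space UNIV) (\<lambda>u. i (L2_fun X' u))"
    unfolding law_def by (simp add: distr_distr comp_def)
  have "(\<lambda>u. i (L2_fun X u)) \<in> measurable borel (count_space UNIV)"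
    "(\<lambda>u. i (L2_fun X' u)) \<in> measurable unit_prob (count_space UNIV)"
    "L2_fun Y' \<in> borel_measurable unit_prob"
    by measurable
  from discrete_transfer[OF unit_prob.prob_space_axioms this cell_law]
  obtain y where [measurable]: "y \<in> borel_measurable borel"
    and y: "distr unit_prob ?P (\<lambda>u. (i (L2_fun X u), y u)) = distr unit_prob ?P (\<lambda>u. (i (L2_fun X' u), L2_fun Y' u))"
    by blast
  have "distr (distr unit_prob ?P (\<lambda>u. (i (L2_fun X u), y u))) borel snd =
      distr (distr unit_prob ?P (\<lambda>u. (i (L2_fun X' u), L2_fun Y' u))) borel snd"
    by (simp add: y)
  then have law_y: "distr unit_prob borel y = law Y'"
    by (simp add: distr_distr comp_def law_def)
  have "integrable (distr unit_prob borel y) (\<lambda>x. (norm x)\<^sup>2)"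
    using law_P2[of Y'] unfolding law_y by (simp add: P2_def)
  then have sq_y: "square_integrable y"
    by (simp add: square_integrable_def integrable_distr_eq)
  define Y where "Y = L2_class y"
  have "law Y = \<nu>" by (simp add: Y_def law_L2_class sq_y law_y Y')
  then have "norm Y = norm Y'" using Y' m2_law by metis
  let ?Z = "\<lambda>X. L2_class (\<lambda>u. p (i (L2_fun X u)))"
  \<comment> \<open>The inner product with a variable constant on cells depends only on the joint
    law of the cell index and the other variable, which the transfer preserves.\<close>
  have "?Z X \<bullet> Y = (LINT u|unit_prob. p (i (L2_fun X u)) \<bullet> y u)"
    unfolding inner_L2_eq
  proof (rule integral_cong_AE)
    show "AE u in unit_prob. L2_fun (?Z X) u \<bullet> L2_fun Y u = p (i (L2_fun X u)) \<bullet> y u"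
      using L2_fun_class[OF cell[of X]] L2_fun_class[OF sq_y] unfolding Y_def by eventually_elim simp
  qed measurable
  also have "\<dots> = (LINT z|distr unit_prob ?P (\<lambda>u. (i (L2_fun X u), y u)). p (fst z) \<bullet> snd z)"
    by (subst integral_distr) auto
  also have "\<dots> = (LINT u|unit_prob. p (i (L2_fun X' u)) \<bullet> L2_fun Y' u)"
    unfolding y by (subst integral_distr) auto
  also have "\<dots> = ?Z X' \<bullet> Y'"
    unfolding inner_L2_eq
  proof (rule integral_cong_AE)
    show "AE u in unit_prob. p (i (L2_fun X' u)) \<bullet> L2_fun Y' u = L2_fun (?Z X') u \<bullet> L2_fun Y' u"
      using L2_fun_class[OF cell[of X']] by eventually_elim simp
  qed measurable
  finally have Z: "?Z X \<bullet> Y = ?Z X' \<bullet> Y'" .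
  have "\<bar>(Z - ?Z Z) \<bullet> W\<bar> \<le> e * norm W" for Z W
    using Cauchy_Schwarz_ineq2[of "Z - ?Z Z" W] mult_right_mono[OF cell_norm[of Z] norm_ge_zero[of W]] by linarith
  from this[of X Y] this[of X' Y'] have "X' \<bullet> Y' - 2 * (e * norm Y') \<le> X \<bullet> Y"
    using Z \<open>norm Y = norm Y'\<close> by (simp add: inner_diff_left)
  moreover have "2 * (e * norm Y') + e = X' \<bullet> Y' - c" using e by (simp add: algebra_simps)
  ultimately have "c < X \<bullet> Y" using \<open>0 < e\<close> by linarith
  with \<open>law Y = \<nu>\<close> show ?thesis by (rule that)
qed

section \<open>Total convexity and c-concavity\<close>

text \<open>\<open>corr_transfer\<close> keeps the interpolated variable fixed, so one near-optimal
  \<open>Z\<close> competes for \<open>X\<close> and \<open>Y\<close> at once, and the inner product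
  is linear.\<close>

lemma corr_interpolation_le:
  assumes "\<nu> \<in> P2" "0 \<le> t" "t \<le> 1"
  shows "corr (law ((1 - t) *\<^sub>R X + t *\<^sub>R Y)) \<nu> \<le> (1 - t) * corr (law X) \<nu> + t * corr (law Y) \<nu>"
proof (rule dense_le)
  fix c assume "c < corr (law ((1 - t) *\<^sub>R X + t *\<^sub>R Y)) \<nu>"
  then obtain Z where Z: "law Z = \<nu>" "c < ((1 - t) *\<^sub>R X + t *\<^sub>R Y) \<bullet> Z"
    by (rule corr_transfer[OF assms(1)])
  have "(1 - t) * (X \<bullet> Z) + t * (Y \<bullet> Z) \<le> (1 - t) * corr (law X) \<nu> + t * corr (law Y) \<nu>"
    using inner_le_corr[of X Z] inner_le_corr[of Y Z] assms Z(1) by (intro add_mono mult_left_mono) auto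
  then show "c \<le> (1 - t) * corr (law X) \<nu> + t * corr (law Y) \<nu>"
    using Z(2) by (simp add: inner_add_left)
qed

text \<open>A \<open>Z\<close> nearly optimal for \<open>X\<close> is a competitor for
  \<open>Y\<close>; Cauchy-Schwarz pays for the difference.\<close>

lemma corr_lipschitz:
  assumes "\<nu> \<in> P2"
  shows "corr (law X) \<nu> \<le> corr (law Y) \<nu> + norm (X - Y) * m2 \<nu>"
proof (rule dense_le)
  fix c assume "c < corr (law X) \<nu>"
  then obtain Z where Z: "law Z = \<nu>" "c < X \<bullet> Z" by (rule corr_transfer[OF assms])
  have "X \<bullet> Z = Y \<bullet> Z + (X - Y) \<bullet> Z" by (simp add: inner_diff_left)
  also have "\<dots> \<le> corr (law Y) \<nu> + norm (X - Y) * m2 \<nu>"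
    using inner_le_corr[of Y Z] norm_cauchy_schwarz[of "X - Y" Z] Z(1) m2_law[of Z] by (intro add_mono) auto
  finally show "c \<le> corr (law Y) \<nu> + norm (X - Y) * m2 \<nu>" using Z(2) by simp
qed

lemma corr_w2_continuous:
  assumes "\<mu> \<in> P2" "\<mu>' \<in> P2" "\<nu> \<in> P2" "w2 \<mu> \<mu>' < \<delta>"
  shows "corr \<mu> \<nu> \<le> corr \<mu>' \<nu> + \<delta> * m2 \<nu>"
    and "m2 \<mu>' \<le> m2 \<mu> + \<delta>"
proof -
  obtain X Y where XY: "law X = \<mu>" "law Y = \<mu>'" "norm (X - Y) < \<delta>"
    using w2_lessE[OF assms(1,2,4)] by blast
  have "0 \<le> m2 \<nu>" by (simp add: m2_def integral_nonneg_AE)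
  then have "norm (X - Y) * m2 \<nu> \<le> \<delta> * m2 \<nu>" using XY(3) by (intro mult_right_mono) auto
  then show "corr \<mu> \<nu> \<le> corr \<mu>' \<nu> + \<delta> * m2 \<nu>"
    using corr_lipschitz[OF assms(3), of X Y] XY by simp
  show "m2 \<mu>' \<le> m2 \<mu> + \<delta>"
    using norm_triangle_ineq2[of Y X] XY m2_law[of X] m2_law[of Y] by (simp add: norm_minus_commute)
qed

section \<open>Suprema of correlation functionals\<close>

definition corr_sup ::
  "('a::{real_inner, polish_space} measure \<times> real) set \<Rightarrow> 'a measure \<Rightarrow> ereal" where
  "corr_sup B \<mu> = (SUP (\<nu>, b)\<in>B. ereal (corr \<mu> \<nu> - b))"

lemma corr_sup_upper: "(\<nu>, b) \<in> B \<Longrightarrow> ereal (corr \<mu> \<nu> - b) \<le> corr_sup B \<mu>"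
  unfolding corr_sup_def by (rule SUP_upper2) auto

text \<open>Each \<open>corr \<cdot> \<nu> - b\<close> is convex along interpolations of variables,
  and suprema preserve this; an empty \<open>B\<close> gives the constant
  \<open>-\<infinity>\<close>.\<close>

lemma totally_convex_corr_sup:
  assumes B: "B \<subseteq> P2 \<times> UNIV" and \<phi>: "\<And>\<mu>. \<mu> \<in> P2 \<Longrightarrow> \<phi> \<mu> = corr_sup B \<mu>"
  shows "totally_convex \<phi>"
  unfolding totally_convex_def
proof (intro ballI)
  fix M :: "('a \<times> 'a) measure" and t :: real
  assume "M \<in> P2" and t: "t \<in> {0..1}"
  obtain X Y where M: "joint X Y = M" using P2_pair_representation[OF \<open>M \<in> P2\<close>] by blast
  have "\<phi> (law ((1 - t) *\<^sub>R X + t *\<^sub>R Y)) \<le> ereal (1 - t) * \<phi> (law X) + ereal t * \<phi> (law Y)"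
    unfolding \<phi>[OF law_P2]
  proof (subst corr_sup_def, rule SUP_least, clarify)
    fix \<nu> b assume \<nu>: "(\<nu>, b) \<in> B"
    then have "\<nu> \<in> P2" using B by auto
    then have "corr (law ((1 - t) *\<^sub>R X + t *\<^sub>R Y)) \<nu> - b \<le>
        (1 - t) * (corr (law X) \<nu> - b) + t * (corr (law Y) \<nu> - b)"
      using corr_interpolation_le[of \<nu> t X Y] t by (simp add: algebra_simps)
    then have "ereal (corr (law ((1 - t) *\<^sub>R X + t *\<^sub>R Y)) \<nu> - b) \<le>
        ereal (1 - t) * ereal (corr (law X) \<nu> - b) + ereal t * ereal (corr (law Y) \<nu> - b)"
      by simp
    also have "\<dots> \<le> ereal (1 - t) * corr_sup B (law X) + ereal t * corr_sup B (law Y)"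
      using t by (intro add_mono ereal_mult_left_mono corr_sup_upper \<nu>) auto
    finally show "ereal (corr (law ((1 - t) *\<^sub>R X + t *\<^sub>R Y)) \<nu> - b) \<le>
        ereal (1 - t) * corr_sup B (law X) + ereal t * corr_sup B (law Y)" .
  qed
  then show "\<phi> (distr M borel (\<lambda>(x, y). (1 - t) *\<^sub>R x + t *\<^sub>R y))
      \<le> ereal (1 - t) * \<phi> (distr M borel fst) + ereal t * \<phi> (distr M borel snd)"
    unfolding M[symmetric] joint_interpolation joint_fst joint_snd .
qed

lemma lsc_corr_sup:
  assumes B: "B \<subseteq> P2 \<times> UNIV" and \<phi>: "\<And>\<mu>. \<mu> \<in> P2 \<Longrightarrow> \<phi> \<mu> = corr_sup B \<mu>"
  shows "lsc_w2 \<phi>"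
  unfolding lsc_w2_def
proof (intro ballI allI impI)
  fix \<mu> r assume "\<mu> \<in> P2" "r < \<phi> \<mu>"
  then have "r < corr_sup B \<mu>" by (simp add: \<phi>)
  then obtain \<nu> b where \<nu>: "(\<nu>, b) \<in> B" "r < ereal (corr \<mu> \<nu> - b)"
    unfolding corr_sup_def less_SUP_iff by auto
  then have "\<nu> \<in> P2" using B by auto
  obtain s where s: "r < ereal s" "s < corr \<mu> \<nu> - b" using ereal_dense2[OF \<nu>(2)] by auto
  \<comment> \<open>The Lipschitz loss \<open>\<delta> * m2 \<nu>\<close> then stays within the gap
    between \<open>corr \<mu> \<nu> - b\<close> and \<open>s\<close>; the 1 keeps the denominator
    positive.\<close>
  define \<delta> where "\<delta> = (corr \<mu> \<nu> - b - s) / (m2 \<nu> + 1)"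
  have "0 \<le> m2 \<nu>" by (simp add: m2_def integral_nonneg_AE)
  then have "0 < \<delta>" and \<delta>: "\<delta> * (m2 \<nu> + 1) = corr \<mu> \<nu> - b - s" using s(2) by (auto simp: \<delta>_def)
  have "r < \<phi> \<mu>'" if "\<mu>' \<in> P2" "w2 \<mu> \<mu>' < \<delta>" for \<mu>'
  proof -
    have "corr \<mu> \<nu> \<le> corr \<mu>' \<nu> + \<delta> * m2 \<nu>"
      using \<open>\<mu> \<in> P2\<close> that \<open>\<nu> \<in> P2\<close> by (intro corr_w2_continuous)
    then have "s \<le> corr \<mu>' \<nu> - b" using \<delta> \<open>0 < \<delta>\<close> by (simp add: algebra_simps)
    then have "ereal s \<le> ereal (corr \<mu>' \<nu> - b)" by simp
    also have "\<dots> \<le> \<phi> \<mu>'"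
      unfolding \<phi>[OF that(1)] by (rule corr_sup_upper[OF \<nu>(1)])
    finally show ?thesis using s(1) by (rule less_le_trans[rotated])
  qed
  with \<open>0 < \<delta>\<close> show "\<exists>\<delta>>0. \<forall>\<nu>\<in>P2. w2 \<mu> \<nu> < \<delta> \<longrightarrow> r < \<phi> \<nu>" by blast
qed

lemma ereal_le_via_less:
  fixes x y :: ereal
  assumes "\<And>r. ereal r < x \<Longrightarrow> ereal r \<le> y"
  shows "x \<le> y"
proof (rule ccontr)
  assume "\<not> x \<le> y"
  then obtain r where "y < ereal r" "ereal r < x" using ereal_dense2[of y x] by (auto simp: not_le)
  with assms show False by (meson not_le)
qed

lemma totally_convex_lsc_imp_corr_sup:
  fixes \<phi> :: "'a::{real_inner, polish_space} measure \<Rightarrow> ereal"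
  assumes not_MInf: "\<And>\<mu>. \<mu> \<in> P2 \<Longrightarrow> \<phi> \<mu> \<noteq> -\<infinity>" and proper: "\<exists>\<mu>\<in>P2. \<phi> \<mu> \<noteq> \<infinity>"
    and "totally_convex \<phi>" "lsc_w2 \<phi>"
  shows "\<exists>B\<subseteq>P2 \<times> UNIV. \<forall>\<mu>\<in>P2. \<phi> \<mu> = corr_sup B \<mu>"
proof -
  \<comment> \<open>Taking all minorants of this form makes one inequality immediate.\<close>
  define B where "B = {(\<nu>, b). \<nu> \<in> P2 \<and> (\<forall>\<mu>\<in>P2. ereal (corr \<mu> \<nu> - b) \<le> \<phi> \<mu>)}"
  define f where "f X = \<phi> (law X)" for X :: "'a L2"
  have convex: "f ((1 - t) *\<^sub>R X + t *\<^sub>R Y) \<le> ereal (1 - t) * f X + ereal t * f Y" if "0 \<le> t" "t \<le> 1" for X Y t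
  proof -
    have "\<phi> (distr (joint X Y) borel (\<lambda>(x, y). (1 - t) *\<^sub>R x + t *\<^sub>R y))
      \<le> ereal (1 - t) * \<phi> (distr (joint X Y) borel fst) + ereal t * \<phi> (distr (joint X Y) borel snd)"
      using assms(3) that joint_P2[of X Y] unfolding totally_convex_def by (meson atLeastAtMost_iff)
    then show ?thesis unfolding joint_interpolation joint_fst joint_snd f_def .
  qed
  have lsc: "\<exists>\<delta>>0. \<forall>Y. dist X Y < \<delta> \<longrightarrow> ereal r < f Y" if r: "ereal r < f X" for X r
  proof -
    obtain \<delta> where "0 < \<delta>" and \<delta>: "\<And>\<nu>. \<nu> \<in> P2 \<Longrightarrow> w2 (law X) \<nu> < \<delta> \<Longrightarrow> ereal r < \<phi> \<nu>"
      using assms(4) r law_P2[of X] unfolding lsc_w2_def f_def by blast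
    have "ereal r < f Y" if "dist X Y < \<delta>" for Y
      unfolding f_def using w2_law_le[of X Y] that by (intro \<delta>) (auto simp: dist_norm)
    with \<open>0 < \<delta>\<close> show ?thesis by blast
  qed
  obtain X0 where X0: "f X0 \<noteq> \<infinity>" using proper P2_representation unfolding f_def by metis
  have f_not_MInf: "f X \<noteq> -\<infinity>" for X using not_MInf[OF law_P2] by (simp add: f_def)
  have "\<phi> \<mu> = corr_sup B \<mu>" if "\<mu> \<in> P2" for \<mu>
  proof (rule antisym)
    show "corr_sup B \<mu> \<le> \<phi> \<mu>"
      unfolding corr_sup_def B_def using that by (auto intro!: SUP_least)
    obtain Z where Z: "law Z = \<mu>" using P2_representation[OF \<open>\<mu> \<in> P2\<close>] by blast
    show "\<phi> \<mu> \<le> corr_sup B \<mu>"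
    proof (rule ereal_le_via_less)
      fix r assume "ereal r < \<phi> \<mu>"
      then have "ereal r < f Z" by (simp add: f_def Z)
      from convex_lsc_affine_minorant[OF convex lsc f_not_MInf X0 this]
      obtain Y a where Y: "\<And>X. ereal (X \<bullet> Y - a) \<le> f X" and r: "r \<le> Z \<bullet> Y - a" by blast
      \<comment> \<open>The affine bound holds for every variable with law \<open>\<mu>'\<close>;
        varying it with \<open>Y\<close> fixed, \<open>corr_transfer\<close> upgrades inner products
        to the correlation.\<close>
      have "ereal (corr \<mu>' (law Y) - a) \<le> \<phi> \<mu>'" if \<mu>': "\<mu>' \<in> P2" for \<mu>'
      proof (cases "\<phi> \<mu>'")
        case (real m)
        have "corr \<mu>' (law Y) \<le> m + a"
        proof (rule ccontr)
          assume "\<not> corr \<mu>' (law Y) \<le> m + a"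
          then have "m + a < corr (law Y) \<mu>'" by (simp add: corr_commute[OF law_P2 \<mu>'])
          then obtain X where X: "law X = \<mu>'" "m + a < Y \<bullet> X" by (rule corr_transfer[OF \<mu>'])
          have "X \<bullet> Y - a \<le> m" using Y[of X] X(1) real by (simp add: f_def)
          then show False using X(2) by (simp add: inner_commute)
        qed
        then show ?thesis by (simp add: real)
      qed (use not_MInf \<mu>' in auto)
      then have "(law Y, a) \<in> B" by (simp add: B_def)
      have "ereal r \<le> ereal (corr \<mu> (law Y) - a)" using r inner_le_corr[of Z Y] Z by simp
      also have "\<dots> \<le> corr_sup B \<mu>" by (rule corr_sup_upper) fact
      finally show "ereal r \<le> corr_sup B \<mu>" .
    qed
  qed
  moreover have "B \<subseteq> P2 \<times> UNIV" by (auto simp: B_def)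
  ultimately show ?thesis by blast
qed

section \<open>Passage between conjugates and c-transforms\<close>

lemma INF_ereal_minus_real: "(INF i\<in>I. ereal c - f i) = ereal c - (SUP i\<in>I. f i)"
  by (cases "I = {}") (simp_all add: INF_ereal_minus_right bot_ereal_def top_ereal_def)

text \<open>A finite minuend lets the quadratic terms be cancelled at infinite values too.\<close>

lemma ereal_real_minus_inject: "ereal c - x = ereal c - y \<longleftrightarrow> x = y"
  by (cases x; cases y) auto

text \<open>The terms in \<open>m2 \<mu>\<close> cancel inside the infimum, and the one in
  \<open>m2 \<nu>\<close> is a constant that can be pulled out.\<close>

lemma c_transform_eq:
  assumes U: "\<And>\<mu>. \<mu> \<in> P2 \<Longrightarrow> U \<mu> = ereal ((1/2) * (m2 \<mu>)\<^sup>2) - \<phi> \<mu>" and "\<nu> \<in> P2"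
  shows "c_transform U \<nu> = ereal ((1/2) * (m2 \<nu>)\<^sup>2) - conjugate \<phi> \<nu>"
proof -
  have "ereal (cost \<mu> \<nu>) - U \<mu> = ereal ((1/2) * (m2 \<nu>)\<^sup>2) - (ereal (corr \<nu> \<mu>) - \<phi> \<mu>)" if "\<mu> \<in> P2" for \<mu>
    using that by (cases "\<phi> \<mu>") (simp_all add: U cost_eq assms(2) corr_commute[OF that assms(2)])
  then show ?thesis
    unfolding c_transform_def conjugate_def INF_ereal_minus_real[symmetric] by (intro INF_cong) auto
qed

lemma c_concave_iff_corr_sup:
  assumes U: "\<And>\<mu>. \<mu> \<in> P2 \<Longrightarrow> U \<mu> = ereal ((1/2) * (m2 \<mu>)\<^sup>2) - \<phi> \<mu>"
  shows "c_concave U \<longleftrightarrow> (\<exists>B\<subseteq>P2 \<times> UNIV. \<forall>\<mu>\<in>P2. \<phi> \<mu> = corr_sup B \<mu>)"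
proof -
  \<comment> \<open>The new second component \<open>b\<close> turns
    \<open>cost \<mu> \<nu> - a\<close> into the quadratic term of \<open>\<mu>\<close> minus
    \<open>corr \<mu> \<nu> - b\<close>. The map is an involution, so families translate both
    ways.\<close>
  define shift :: "'a measure \<times> real \<Rightarrow> 'a measure \<times> real"
    where "shift p = (fst p, (1/2) * (m2 (fst p))\<^sup>2 - snd p)" for p
  have shift_shift: "shift ` (shift ` A) = A" for A
    by (simp add: image_image shift_def)
  have shift_sub: "shift ` A \<subseteq> P2 \<times> UNIV" if "A \<subseteq> P2 \<times> UNIV" for A
    using that by (auto simp: shift_def)
  have INF_eq: "(INF (\<nu>, a)\<in>A. ereal (cost \<mu> \<nu> - a)) = ereal ((1/2) * (m2 \<mu>)\<^sup>2) - corr_sup (shift ` A) \<mu>"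
    if "A \<subseteq> P2 \<times> UNIV" "\<mu> \<in> P2" for A \<mu>
    unfolding corr_sup_def INF_ereal_minus_real[symmetric] image_image
    using that by (intro INF_cong) (auto simp: shift_def cost_eq)
  have eq: "(U \<mu> = (INF (\<nu>, a)\<in>A. ereal (cost \<mu> \<nu> - a))) \<longleftrightarrow> \<phi> \<mu> = corr_sup (shift ` A) \<mu>"
    if "A \<subseteq> P2 \<times> UNIV" "\<mu> \<in> P2" for A \<mu>
    unfolding INF_eq[OF that] U[OF that(2)] by (rule ereal_real_minus_inject)
  show ?thesis
    unfolding c_concave_def
  proof (intro iffI; elim exE conjE)
    fix A assume "A \<subseteq> P2 \<times> (UNIV :: real set)" "\<forall>\<mu>\<in>P2. U \<mu> = (INF (\<nu>, a)\<in>A. ereal (cost \<mu> \<nu> - a))"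
    then show "\<exists>B\<subseteq>P2 \<times> UNIV. \<forall>\<mu>\<in>P2. \<phi> \<mu> = corr_sup B \<mu>"
      using eq shift_sub by (intro exI[of _ "shift ` A"]) auto
  next
    fix B assume "B \<subseteq> P2 \<times> UNIV" "\<forall>\<mu>\<in>P2. \<phi> \<mu> = corr_sup B \<mu>"
    then show "\<exists>A\<subseteq>P2 \<times> (UNIV :: real set). \<forall>\<mu>\<in>P2. U \<mu> = (INF (\<nu>, a)\<in>A. ereal (cost \<mu> \<nu> - a))"
      using eq[of "shift ` B"] shift_sub[of B] by (intro exI[of _ "shift ` B"]) (auto simp: shift_shift)
  qed
qed

text \<open>A single pair \<open>(\<nu>, a)\<close> nearly attaining the infimum at
  \<open>\<mu>\<close> bounds \<open>U\<close> from above everywhere, and its cost varies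
  continuously.\<close>

lemma c_concave_imp_usc:
  assumes "c_concave U" shows "usc_w2 U"
  unfolding usc_w2_def
proof (intro ballI allI impI)
  fix \<mu> r assume "\<mu> \<in> P2" and r: "U \<mu> < r"
  obtain A where A: "A \<subseteq> P2 \<times> (UNIV :: real set)"
    and U: "\<And>\<mu>. \<mu> \<in> P2 \<Longrightarrow> U \<mu> = (INF (\<nu>, a)\<in>A. ereal (cost \<mu> \<nu> - a))"
    using assms unfolding c_concave_def by blast
  from r obtain \<nu> a where \<nu>: "(\<nu>, a) \<in> A" "ereal (cost \<mu> \<nu> - a) < r"
    unfolding U[OF \<open>\<mu> \<in> P2\<close>] INF_less_iff by auto
  then have "\<nu> \<in> P2" using A by auto
  obtain s where s: "ereal s < r" "cost \<mu> \<nu> - a < s" using ereal_dense2[OF \<nu>(2)] by auto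
  define e where "e = s - (cost \<mu> \<nu> - a)"
  \<comment> \<open>The cost grows by at most \<open>\<delta> * (m2 \<mu> + m2 \<nu> + 1)\<close>;
    the bound \<open>\<delta> \<le> 1\<close> absorbs the term
    \<open>\<delta> * \<delta>\<close>.\<close>
  define \<delta> where "\<delta> = min 1 (e / (m2 \<mu> + m2 \<nu> + 1))"
  have m2: "0 \<le> m2 \<mu>" for \<mu> :: "'a measure" by (simp add: m2_def integral_nonneg_AE)
  have "0 < e" using s(2) by (simp add: e_def)
  have pos: "0 < m2 \<mu> + m2 \<nu> + 1" using m2[of \<mu>] m2[of \<nu>] by linarith
  then have "0 < \<delta>" "\<delta> \<le> 1" using \<open>0 < e\<close> by (auto simp: \<delta>_def)
  have "\<delta> \<le> e / (m2 \<mu> + m2 \<nu> + 1)" by (simp add: \<delta>_def)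
  then have \<delta>: "\<delta> * (m2 \<mu> + m2 \<nu> + 1) \<le> e" using pos by (simp add: pos_le_divide_eq)
  have "U \<mu>' < r" if "\<mu>' \<in> P2" "w2 \<mu> \<mu>' < \<delta>" for \<mu>'
  proof -
    note cont = corr_w2_continuous[OF \<open>\<mu> \<in> P2\<close> that(1) \<open>\<nu> \<in> P2\<close> that(2)]
    have "(m2 \<mu>')\<^sup>2 \<le> (m2 \<mu> + \<delta>)\<^sup>2" using cont(2) m2 by (rule power_mono)
    also have "\<dots> = (m2 \<mu>)\<^sup>2 + 2 * (\<delta> * m2 \<mu>) + \<delta> * \<delta>" by (simp add: power2_eq_square algebra_simps)
    finally have "(m2 \<mu>')\<^sup>2 \<le> (m2 \<mu>)\<^sup>2 + 2 * (\<delta> * m2 \<mu>) + \<delta> * \<delta>" .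
    moreover have "\<delta> * \<delta> \<le> \<delta>" using \<open>0 < \<delta>\<close> \<open>\<delta> \<le> 1\<close> mult_left_mono[of \<delta> 1 \<delta>] by simp
    moreover have "\<delta> * m2 \<mu> + \<delta> * m2 \<nu> + \<delta> \<le> e" using \<delta> by (simp add: distrib_left)
    ultimately have "cost \<mu>' \<nu> - a \<le> s"
      using cont(1) \<open>0 < \<delta>\<close>
      unfolding e_def cost_eq[OF \<open>\<mu> \<in> P2\<close> \<open>\<nu> \<in> P2\<close>] cost_eq[OF that(1) \<open>\<nu> \<in> P2\<close>] by argo
    have "U \<mu>' \<le> ereal (cost \<mu>' \<nu> - a)"
      unfolding U[OF that(1)] by (rule INF_lower2[OF \<nu>(1)]) simp
    also have "\<dots> \<le> ereal s" using \<open>cost \<mu>' \<nu> - a \<le> s\<close> by simp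
    finally show ?thesis using s(1) by (rule le_less_trans)
  qed
  with \<open>0 < \<delta>\<close> show "\<exists>\<delta>>0. \<forall>\<nu>\<in>P2. w2 \<mu> \<nu> < \<delta> \<longrightarrow> U \<nu> < r" by blast
qed

lemma subdiff_iff_c_superdiff:
  assumes U: "\<And>\<mu>. \<mu> \<in> P2 \<Longrightarrow> U \<mu> = ereal ((1/2) * (m2 \<mu>)\<^sup>2) - \<phi> \<mu>"
    and "\<And>\<mu>. \<mu> \<in> P2 \<Longrightarrow> \<phi> \<mu> \<noteq> -\<infinity>" and \<mu>: "\<mu> \<in> P2" "\<bar>\<phi> \<mu>\<bar> \<noteq> \<infinity>"
  shows "\<nu> \<in> subdiff \<phi> \<mu> \<longleftrightarrow> \<nu> \<in> c_superdiff U \<mu>"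
proof -
  obtain p where p: "\<phi> \<mu> = ereal p" using \<mu>(2) by (cases "\<phi> \<mu>") auto
  \<comment> \<open>If \<open>\<phi> \<mu>'\<close> is infinite both inequalities are trivial;
    otherwise the quadratic terms cancel in the differences.\<close>
  have "\<phi> \<mu>' - \<phi> \<mu> \<ge> ereal (corr \<mu>' \<nu> - corr \<mu> \<nu>) \<longleftrightarrow> U \<mu>' - U \<mu> \<le> ereal (cost \<mu>' \<nu> - cost \<mu> \<nu>)"
    if "\<mu>' \<in> P2" "\<nu> \<in> P2" for \<mu>'
    using assms(2)[OF that(1)]
    by (cases "\<phi> \<mu>'") (auto simp: U \<mu>(1) that p cost_eq)
  then show ?thesis unfolding subdiff_def c_superdiff_def by auto
qed

theorem corollary3p15:
  fixes \<phi> \<psi> U V :: "'h::{real_inner, polish_space} measure \<Rightarrow> ereal"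
  assumes "\<And>\<mu>. \<mu> \<in> P2 \<Longrightarrow> \<phi> \<mu> \<noteq> -\<infinity>"
    and "\<And>\<mu>. \<mu> \<in> P2 \<Longrightarrow> \<psi> \<mu> \<noteq> -\<infinity>"
    and proper: "\<exists>\<mu>\<in>P2. \<phi> \<mu> \<noteq> \<infinity>"
    and U: "\<And>\<mu>. \<mu> \<in> P2 \<Longrightarrow> U \<mu> = ereal ((1/2) * (m2 \<mu>)\<^sup>2) - \<phi> \<mu>"
    and V: "\<And>\<mu>. \<mu> \<in> P2 \<Longrightarrow> V \<mu> = ereal ((1/2) * (m2 \<mu>)\<^sup>2) - \<psi> \<mu>"
  shows "((\<forall>\<nu>\<in>P2. \<psi> \<nu> = conjugate \<phi> \<nu>) \<longleftrightarrow> (\<forall>\<nu>\<in>P2. V \<nu> = c_transform U \<nu>)) \<and>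
    (totally_convex \<phi> \<and> lsc_w2 \<phi> \<longleftrightarrow> c_concave U) \<and> (c_concave U \<longrightarrow> usc_w2 U) \<and>
    (\<forall>\<mu>\<in>P2. \<forall>\<nu>\<in>P2. \<bar>\<phi> \<mu>\<bar> \<noteq> \<infinity> \<longrightarrow>
       \<bar>U \<mu>\<bar> \<noteq> \<infinity> \<and> (\<nu> \<in> subdiff \<phi> \<mu> \<longleftrightarrow> \<nu> \<in> c_superdiff U \<mu>))"
proof -
  have "(\<forall>\<nu>\<in>P2. \<psi> \<nu> = conjugate \<phi> \<nu>) \<longleftrightarrow> (\<forall>\<nu>\<in>P2. V \<nu> = c_transform U \<nu>)"
    by (intro ball_cong refl) (simp only: V c_transform_eq[OF U] ereal_real_minus_inject)
  moreover have "totally_convex \<phi> \<and> lsc_w2 \<phi> \<longleftrightarrow> c_concave U"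
  proof -
    have "c_concave U \<longleftrightarrow> (\<exists>B\<subseteq>P2 \<times> UNIV. \<forall>\<mu>\<in>P2. \<phi> \<mu> = corr_sup B \<mu>)"
      by (rule c_concave_iff_corr_sup) (rule U)
    moreover have "totally_convex \<phi> \<Longrightarrow> lsc_w2 \<phi> \<Longrightarrow> \<exists>B\<subseteq>P2 \<times> UNIV. \<forall>\<mu>\<in>P2. \<phi> \<mu> = corr_sup B \<mu>"
      by (rule totally_convex_lsc_imp_corr_sup) (use assms(1) proper in auto)
    moreover have "totally_convex \<phi> \<and> lsc_w2 \<phi>" if "B \<subseteq> P2 \<times> UNIV" "\<forall>\<mu>\<in>P2. \<phi> \<mu> = corr_sup B \<mu>" for B
      using that totally_convex_corr_sup[of B \<phi>] lsc_corr_sup[of B \<phi>] by auto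
    ultimately show ?thesis by blast
  qed
  moreover have "\<bar>U \<mu>\<bar> \<noteq> \<infinity>" if "\<mu> \<in> P2" "\<bar>\<phi> \<mu>\<bar> \<noteq> \<infinity>" for \<mu>
    using that by (cases "\<phi> \<mu>") (auto simp: U)
  moreover have "\<nu> \<in> subdiff \<phi> \<mu> \<longleftrightarrow> \<nu> \<in> c_superdiff U \<mu>" if "\<mu> \<in> P2" "\<bar>\<phi> \<mu>\<bar> \<noteq> \<infinity>" for \<mu> \<nu>
    by (rule subdiff_iff_c_superdiff) (use U assms(1) that in auto)
  ultimately show ?thesis
    using c_concave_imp_usc[of U] by (intro conjI ballI impI) blast+
qed

end
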